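(* A connected outer 1-planar graph $G$ is cop-win if and only if $G$ is chordal.
   Context: A graph is outer 1-planar if it can be drawn in the plane with all vertices in convex position on the outer boundary and each edge crossed at most once (drawings are simple). Cops and Robbers: cops are placed on vertices first, then the robber; players alternate turns, cops each moving along an edge or staying, robber moving along an edge or staying; full information; the cops win if a cop occupies the robber's vertex. A graph is cop-win if a single cop can always catch the robber. A graph is chordal if it has no induced cycle of length at least four. *)

theory Defs
  imports "HOL-Analysis.Analysis" "Graph_Theory.Graph_Theory"
begin

text \<open>
  Finite simple undirected graphs are the symmetric digraphs of the locale \<^locale>\<open>graph\<close>.
  The two opposite arcs between adjacent vertices form one undirected edge.
\<close>

definition uedges :: "('a, 'b) pre_digraph \<Rightarrow> 'a set set" where
  "uedges G = {{u, v} | u v. u \<rightarrow>\<^bsub>G\<^esub> v}"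


section \<open>Outer 1-planar graphs\<close>

text \<open>
  \<open>S\<close> and \<open>T\<close> cross properly at \<open>x\<close> if, near \<open>x\<close>, they look like the two coordinate axes near 0.
  This rules out touching points and end points of arcs.
\<close>

definition proper_crossing :: "complex set \<Rightarrow> complex set \<Rightarrow> complex \<Rightarrow> bool" where
  "proper_crossing S T x \<longleftrightarrow>
    (\<exists>N h k. open N \<and> x \<in> N \<and> homeomorphism N (ball (0::complex) 1) h k \<and> h x = 0 \<and>
       h ` (S \<inter> N) = {z \<in> ball 0 1. Im z = 0} \<and>
       h ` (T \<inter> N) = {z \<in> ball 0 1. Re z = 0})"

text \<open>
  In a drawing, \<open>p v\<close> is the position of the vertex \<open>v\<close> and \<open>c e\<close> the curve of the edge \<open>e\<close>.
\<close>

definition simple_drawing ::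
  "('a, 'b) pre_digraph \<Rightarrow> ('a \<Rightarrow> complex) \<Rightarrow> ('a set \<Rightarrow> real \<Rightarrow> complex) \<Rightarrow> bool" where
  "simple_drawing G p c \<longleftrightarrow>
    inj_on p (verts G) \<and>
    (\<forall>e \<in> uedges G. arc (c e) \<and> {pathstart (c e), pathfinish (c e)} = p ` e \<and>
       path_image (c e) \<inter> p ` verts G = p ` e) \<and>
    (\<forall>e \<in> uedges G. \<forall>f \<in> uedges G. e \<noteq> f \<longrightarrow>
       (\<forall>x \<in> path_image (c e) \<inter> path_image (c f).
          x \<in> p ` (e \<inter> f) \<or> proper_crossing (path_image (c e)) (path_image (c f)) x) \<and>
       (\<forall>x \<in> path_image (c e) \<inter> path_image (c f).
        \<forall>y \<in> path_image (c e) \<inter> path_image (c f). x = y))"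

definition crossings ::
  "('a, 'b) pre_digraph \<Rightarrow> ('a set \<Rightarrow> real \<Rightarrow> complex) \<Rightarrow> 'a set \<Rightarrow> ('a set \<times> complex) set" where
  "crossings G c e = {(f, x). f \<in> uedges G \<and> f \<noteq> e \<and>
     proper_crossing (path_image (c e)) (path_image (c f)) x}"

definition drawing_image ::
  "('a, 'b) pre_digraph \<Rightarrow> ('a \<Rightarrow> complex) \<Rightarrow> ('a set \<Rightarrow> real \<Rightarrow> complex) \<Rightarrow> complex set" where
  "drawing_image G p c = p ` verts G \<union> (\<Union>e \<in> uedges G. path_image (c e))"

text \<open>
  The vertices are the corners of a convex polygon, and this polygon bounds the drawing.
  The edges need not be straight. The lemma \<open>convex_drawing_outer_face\<close> below shows that
  every vertex then lies on the boundary of the unbounded face.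
\<close>

definition convex_drawing ::
  "('a, 'b) pre_digraph \<Rightarrow> ('a \<Rightarrow> complex) \<Rightarrow> ('a set \<Rightarrow> real \<Rightarrow> complex) \<Rightarrow> bool" where
  "convex_drawing G p c \<longleftrightarrow>
    (\<forall>v \<in> verts G. p v \<notin> convex hull (p ` (verts G - {v}))) \<and>
    drawing_image G p c \<subseteq> convex hull (p ` verts G)"

definition outer_1_planar :: "('a, 'b) pre_digraph \<Rightarrow> bool" where
  "outer_1_planar G \<longleftrightarrow>
    (\<exists>p c. simple_drawing G p c \<and> convex_drawing G p c \<and>
       (\<forall>e \<in> uedges G. finite (crossings G c e) \<and> card (crossings G c e) \<le> 1))"

lemma convex_drawing_outer_face:
  assumes "finite (verts G)" "convex_drawing G p c" "v \<in> verts G"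
  shows "p v \<in> frontier (outside (drawing_image G p c))"
proof -
  let ?K = "drawing_image G p c"
  let ?H = "convex hull (p ` verts G)"
  let ?H' = "convex hull (p ` (verts G - {v}))"
  have KH: "?K \<subseteq> ?H" and nin: "p v \<notin> ?H'"
    using assms by (auto simp: convex_drawing_def)
  have "closed ?H'"
    using assms(1) by (simp add: compact_convex_hull compact_imp_closed finite_imp_compact)
  then obtain a b where ab: "inner a (p v) < b" "\<forall>x \<in> ?H'. inner a x > b"
    using separating_hyperplane_closed_point[of ?H' "p v"] nin by auto
  have "p ` verts G \<subseteq> {x. inner a x \<ge> inner a (p v)}"
  proof
    fix x assume "x \<in> p ` verts G"
    then obtain w where w: "w \<in> verts G" "x = p w" by auto
    show "x \<in> {x. inner a x \<ge> inner a (p v)}"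
    proof (cases "w = v")
      case False
      then have "x \<in> ?H'" using w by (auto intro: hull_inc)
      then show ?thesis using ab by force
    qed (use w in auto)
  qed
  then have H: "?H \<subseteq> {x. inner a x \<ge> inner a (p v)}"
    by (intro hull_minimal) (auto simp: convex_halfspace_ge)
  have "bounded ?H"
    using assms(1) by (simp add: bounded_convex_hull finite_imp_bounded)
  then have out: "- ?H \<subseteq> outside ?K"
    using outside_mono[OF KH] outside_convex[of ?H] by (simp add: convex_convex_hull)
  have "p v \<in> closure (outside ?K)"
  proof (cases "a = 0")
    case True
    then have "?H' = {}" using ab by fastforce
    then have "verts G = {v}" using assms(3) by auto
    then have "outside ?K \<supseteq> - {p v}" using out by simp
    moreover have "closure (- {p v}) = UNIV"
      using closure_complement[of "{p v}"] by simp
    ultimately show ?thesis using closure_mono by blast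
  next
    case False
    show ?thesis
      unfolding closure_sequential
    proof (intro exI conjI allI)
      fix n
      have "inner a (p v - (1 / real (Suc n)) *\<^sub>R a) < inner a (p v)"
        using False by (simp add: inner_diff_right)
      then show "p v - (1 / real (Suc n)) *\<^sub>R a \<in> outside ?K"
        using H out by force
    next
      have "(\<lambda>n. p v - (1 / real (Suc n)) *\<^sub>R a) \<longlonglongrightarrow> p v - 0 *\<^sub>R a"
        by (intro tendsto_intros LIMSEQ_Suc lim_1_over_n)
      then show "(\<lambda>n. p v - (1 / real (Suc n)) *\<^sub>R a) \<longlonglongrightarrow> p v" by simp
    qed
  qed
  moreover have "p v \<in> ?K" using assms(3) by (auto simp: drawing_image_def)
  then have "p v \<notin> outside ?K" by (meson disjoint_iff outside_no_overlap)
  then have "p v \<notin> interior (outside ?K)" using interior_subset by blast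
  ultimately show ?thesis by (simp add: frontier_def)
qed


section \<open>Cops and Robbers\<close>

definition legal_move :: "('a, 'b) pre_digraph \<Rightarrow> 'a \<Rightarrow> 'a \<Rightarrow> bool" where
  "legal_move G u v \<longleftrightarrow> u \<in> verts G \<and> v \<in> verts G \<and> (u = v \<or> u \<rightarrow>\<^bsub>G\<^esub> v)"

definition robber_play :: "('a, 'b) pre_digraph \<Rightarrow> (nat \<Rightarrow> 'a) \<Rightarrow> bool" where
  "robber_play G r \<longleftrightarrow> (\<forall>n. legal_move G (r n) (r (Suc n)))"

text \<open>
  A strategy \<open>s\<close> for the cops maps the list of all positions of the robber so far to the list of
  the cops' next positions. In particular, \<open>s []\<close> is the initial placement of the cops,
  made before the robber chooses \<open>r 0\<close>. The cops' own earlier positions are determined by \<open>s\<close>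
  and the history, so this is the general form of a deterministic strategy with full information.
\<close>

definition cops_at :: "('a list \<Rightarrow> 'a list) \<Rightarrow> (nat \<Rightarrow> 'a) \<Rightarrow> nat \<Rightarrow> 'a list" where
  "cops_at s r n = s (map r [0..<n])"

definition cop_strategy :: "('a, 'b) pre_digraph \<Rightarrow> nat \<Rightarrow> ('a list \<Rightarrow> 'a list) \<Rightarrow> bool" where
  "cop_strategy G k s \<longleftrightarrow>
    length (s []) = k \<and> set (s []) \<subseteq> verts G \<and>
    (\<forall>r n. robber_play G r \<longrightarrow> list_all2 (legal_move G) (cops_at s r n) (cops_at s r (Suc n)))"

text \<open>
  The robber stands on \<open>r n\<close> from his \<open>n\<close>-th choice until his next one. During this time, the
  cops move from \<open>cops_at s r n\<close> to \<open>cops_at s r (Suc n)\<close>, so he may be caught by his own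
  choice or by that move. Play is formally continued after a capture, which affects nothing.
\<close>

definition cops_win :: "('a, 'b) pre_digraph \<Rightarrow> nat \<Rightarrow> bool" where
  "cops_win G k \<longleftrightarrow>
    (\<exists>s. cop_strategy G k s \<and>
      (\<forall>r. robber_play G r \<longrightarrow>
        (\<exists>n. r n \<in> set (cops_at s r n) \<or> r n \<in> set (cops_at s r (Suc n)))))"

definition cop_win :: "('a, 'b) pre_digraph \<Rightarrow> bool" where
  "cop_win G \<longleftrightarrow> cops_win G 1"


section \<open>Chordal graphs\<close>

definition induced_cycle :: "('a, 'b) pre_digraph \<Rightarrow> 'a list \<Rightarrow> bool" where
  "induced_cycle G vs \<longleftrightarrow>
    3 \<le> length vs \<and> distinct vs \<and> set vs \<subseteq> verts G \<and>
    (\<forall>i < length vs. \<forall>j < length vs.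
       vs ! i \<rightarrow>\<^bsub>G\<^esub> vs ! j \<longleftrightarrow> j = Suc i mod length vs \<or> i = Suc j mod length vs)"

definition chordal :: "('a, 'b) pre_digraph \<Rightarrow> bool" where
  "chordal G \<longleftrightarrow> \<not> (\<exists>vs. induced_cycle G vs \<and> 4 \<le> length vs)"

end

theory Submission
  imports Defs "HOL-Number_Theory.Cong"
begin

text \<open>
  A connected chordal graph has a simplicial vertex (Dirac). Such a vertex is dominated by any of
  its neighbours, so the graph is dismantlable, and a cop who wins after folding the vertex away
  also wins before. Conversely, on a retract with at least two vertices and no dominated vertex
  the robber escapes forever, so a cop-win graph is dismantlable. Re-inserting the dominated
  vertices one by one, the first hole to appear contains the new vertex \<open>v\<close>, and then the vertex
  dominating \<open>v\<close> is the hub of a wheel on this hole. But a wheel with at least four spokes is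
  not outer 1-planar: edges with interleaved end points cross, and among the rim edges that cross
  spokes, two cross each other.
\<close>

section \<open>Paths between interleaved corners of a convex polygon\<close>

text \<open>The curves of a drawing need not be straight, so two edges cannot be compared through
  the lines spanned by their ends. All that is taken from the topology is one fact: curves inside a
  convex polygon that join interleaved pairs of corners meet. Disjoint edges can meet only in a
  proper crossing, so the bound of one crossing per edge becomes a statement about quadruples of
  corners, and what follows is combinatorics of their cyclic order. That order is not part of a
  drawing; it is recovered from the signs of \<open>orient\<close>, which is twice the signed area
  of a triangle.\<close>

definition orient :: "complex \<Rightarrow> complex \<Rightarrow> complex \<Rightarrow> real" where
  "orient a b c = (Re b - Re a) * (Im c - Im a) - (Im b - Im a) * (Re c - Re a)"

text \<open>Four positive triples put the points in convex position in this cyclic order, with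
  \<open>a c\<close> and \<open>b d\<close> as the diagonals.\<close>

definition ccw_quad :: "complex \<Rightarrow> complex \<Rightarrow> complex \<Rightarrow> complex \<Rightarrow> bool" where
  "ccw_quad a b c d \<longleftrightarrow>
    orient a b c > 0 \<and> orient a b d > 0 \<and> orient a c d > 0 \<and> orient b c d > 0"

lemma ccw_quad_rotate: "ccw_quad a b c d \<Longrightarrow> ccw_quad b c d a"
  by (auto simp: ccw_quad_def orient_def algebra_simps)

lemma ccw_quad_distinct: "ccw_quad a b c d \<Longrightarrow> distinct [a, b, c, d]"
  by (auto simp: ccw_quad_def orient_def)

text \<open>Otherwise \<open>P\<close> would lie strictly between two points of
  \<open>H\<close>.\<close>

lemma beyond_extreme_point:
  fixes P Q :: complex
  assumes "P extreme_point_of H" "Q \<in> H" "P \<noteq> Q" "t > 0"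
  shows "P + of_real t * (P - Q) \<notin> H"
proof
  assume *: "P + of_real t * (P - Q) \<in> H"
  \<comment> \<open>The parameter at which the segment from \<open>Q\<close> to the prolonged point
    passes through \<open>P\<close>.\<close>
  define k where "k = 1 / (1 + t)"
  have k: "k * t = 1 - k" using assms(4) by (simp add: k_def field_simps)
  have "x = (1 - k) * y + k * (x + t * (x - y))" for x y :: real
  proof -
    have "(1 - k) * y + k * (x + t * (x - y)) = (1 - k) * y + k * x + (k * t) * (x - y)"
      by (simp add: algebra_simps)
    also have "\<dots> = x" unfolding k by (simp add: algebra_simps)
    finally show ?thesis by simp
  qed
  then have "P = (1 - k) *\<^sub>R Q + k *\<^sub>R (P + of_real t * (P - Q))"
    by (intro complex_eqI) simp_all
  moreover have "Q \<noteq> P + of_real t * (P - Q)"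
  proof
    assume "Q = P + of_real t * (P - Q)"
    then have "of_real (1 + t) * (P - Q) = 0" by (simp add: algebra_simps)
    with assms(3,4) show False
      by (metis add_pos_pos eq_iff_diff_eq_0 less_numeral_extra(1) mult_eq_0_iff of_real_eq_0_iff order_less_irrefl)
  qed
  ultimately have "P \<in> open_segment Q (P + of_real t * (P - Q))"
    unfolding in_segment using assms(4)
    by (intro conjI exI[of _ k]) (auto simp: k_def)
  then show False
    using assms(1,2) * by (auto simp: extreme_point_of_def)
qed

lemma path_extend_line:
  fixes P Q :: complex
  assumes "path f" "pathstart f = P" "pathfinish f = Q"
  obtains f' where "path f'" "pathstart f' = P + of_real s * (P - Q)"
    "pathfinish f' = Q + of_real t * (Q - P)"
    "path_image f' = closed_segment (P + of_real s * (P - Q)) P \<union> path_image f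
       \<union> closed_segment Q (Q + of_real t * (Q - P))"
proof
  let ?f = "(linepath (P + of_real s * (P - Q)) P +++ f) +++ linepath Q (Q + of_real t * (Q - P))"
  show "path ?f" "pathstart ?f = P + of_real s * (P - Q)"
    "pathfinish ?f = Q + of_real t * (Q - P)"
    using assms by auto
  show "path_image ?f = closed_segment (P + of_real s * (P - Q)) P \<union> path_image f
       \<union> closed_segment Q (Q + of_real t * (Q - P))"
    using assms by (simp add: path_image_join)
qed

lemma in_segment_beyond:
  fixes P Q :: complex
  assumes "z \<in> closed_segment (P + of_real s * (P - Q)) P" "s \<ge> 0"
  obtains t where "0 \<le> t" "t \<le> s" "z = P + of_real t * (P - Q)"
proof -
  obtain u where u: "0 \<le> u" "u \<le> 1" "z = (1 - u) *\<^sub>R (P + of_real s * (P - Q)) + u *\<^sub>R P"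
    using assms(1) by (auto simp: in_segment)
  show thesis
  proof
    show "0 \<le> (1 - u) * s" "(1 - u) * s \<le> s"
      using u assms(2) by (auto simp: mult_left_le_one_le)
    show "z = P + of_real ((1 - u) * s) * (P - Q)"
      using u by (simp add: complex_eq_iff algebra_simps)
  qed
qed

text \<open>
  Both paths are prolonged along the lines \<open>AC\<close> and \<open>BD\<close>. As the end points are extreme, the
  prolongations leave \<open>H\<close> at once. In the coordinates \<open>\<alpha>\<close>, \<open>\<beta>\<close>, in which these lines are
  the axes, the prolonged paths connect opposite sides of a square, so they meet by the Fashoda
  theorem. They can only meet within \<open>H\<close>, because the prolongations lie on different axes.
\<close>
lemma crossing_paths_meet:
  assumes H: "bounded H"
    and ext: "A extreme_point_of H" "B extreme_point_of H" "C extreme_point_of H"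
      "D extreme_point_of H"
    and quad: "ccw_quad A B C D"
    and f: "path f" "path_image f \<subseteq> H" "pathstart f = A" "pathfinish f = C"
    and g: "path g" "path_image g \<subseteq> H" "pathstart g = B" "pathfinish g = D"
  shows "path_image f \<inter> path_image g \<noteq> {}"
proof -
  \<comment> \<open>The signs are chosen so that \<open>f\<close> runs from left to right and
    \<open>g\<close> from bottom to top, as \<open>fashoda\<close> expects.\<close>
  define \<alpha> where "\<alpha> z = - orient B D z" for z
  define \<beta> where "\<beta> z = orient A C z" for z
  define \<psi> :: "complex \<Rightarrow> real^2" where
    "\<psi> z = (\<chi> i. if i = 1 then \<alpha> z else \<beta> z)" for z
  have inH: "A \<in> H" "B \<in> H" "C \<in> H" "D \<in> H"
    using ext by (auto simp: extreme_point_of_def)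
  have ne: "A \<noteq> C" "B \<noteq> D" using ccw_quad_distinct[OF quad] by auto
  have signs: "\<alpha> A < 0" "\<alpha> C > 0" "\<beta> B < 0" "\<beta> D > 0" "\<alpha> B = 0" "\<alpha> D = 0" "\<beta> A = 0" "\<beta> C = 0"
    using quad by (auto simp: \<alpha>_def \<beta>_def ccw_quad_def orient_def algebra_simps)
  have aff: "\<alpha> (x + of_real s * (x - y)) = \<alpha> x + s * (\<alpha> x - \<alpha> y)"
    "\<beta> (x + of_real s * (x - y)) = \<beta> x + s * (\<beta> x - \<beta> y)" for x y s
    by (auto simp: \<alpha>_def \<beta>_def orient_def algebra_simps)
  have cont: "continuous_on UNIV \<alpha>" "continuous_on UNIV \<beta>"
    unfolding \<alpha>_def \<beta>_def orient_def by (intro continuous_intros)+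
  have "bounded (\<alpha> ` closure H)" "bounded (\<beta> ` closure H)"
    using H cont by (auto intro!: compact_imp_bounded compact_continuous_image
        intro: continuous_on_subset)
  then obtain R1 R2 where R12: "\<forall>z\<in>closure H. \<bar>\<alpha> z\<bar> \<le> R1" "\<forall>z\<in>closure H. \<bar>\<beta> z\<bar> \<le> R2"
    unfolding bounded_iff by auto
  define R where "R = max R1 R2"
  have R: "\<bar>\<alpha> z\<bar> \<le> R" "\<bar>\<beta> z\<bar> \<le> R" if "z \<in> H" for z
    using R12 that closure_subset[of H] by (fastforce simp: R_def)+
  \<comment> \<open>These lengths make the prolonged paths end exactly on the sides \<alpha> = -R,
    \<alpha> = R and \<beta> = -R, \<beta> = R of the square.\<close>
  define a c b d where "a = (R + \<alpha> A) / (\<alpha> C - \<alpha> A)" and "c = (R - \<alpha> C) / (\<alpha> C - \<alpha> A)"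
    and "b = (R + \<beta> B) / (\<beta> D - \<beta> B)" and "d = (R - \<beta> D) / (\<beta> D - \<beta> B)"
  have nonneg: "a \<ge> 0" "b \<ge> 0" "c \<ge> 0" "d \<ge> 0"
    using R[OF inH(1)] R[OF inH(2)] R[OF inH(3)] R[OF inH(4)] signs
    by (auto simp: a_def b_def c_def d_def)
  have mult: "a * (\<alpha> C - \<alpha> A) = R + \<alpha> A" "c * (\<alpha> C - \<alpha> A) = R - \<alpha> C"
     "b * (\<beta> D - \<beta> B) = R + \<beta> B" "d * (\<beta> D - \<beta> B) = R - \<beta> D"
    using signs by (auto simp: a_def b_def c_def d_def)
  obtain f' where f': "path f'" "pathstart f' = A + of_real a * (A - C)"
    "pathfinish f' = C + of_real c * (C - A)"
    "path_image f' = closed_segment (A + of_real a * (A - C)) A \<union> path_image f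
       \<union> closed_segment C (C + of_real c * (C - A))"
    using path_extend_line[OF f(1,3,4)] by metis
  obtain g' where g': "path g'" "pathstart g' = B + of_real b * (B - D)"
    "pathfinish g' = D + of_real d * (D - B)"
    "path_image g' = closed_segment (B + of_real b * (B - D)) B \<union> path_image g
       \<union> closed_segment D (D + of_real d * (D - B))"
    using path_extend_line[OF g(1,3,4)] by metis
  have f'_cases: "z \<in> path_image f \<or> z \<notin> H \<and> \<beta> z = 0 \<and> \<alpha> z \<noteq> 0 \<and> \<bar>\<alpha> z\<bar> \<le> R"
    if "z \<in> path_image f'" for z
  proof -
    consider "z \<in> closed_segment (A + of_real a * (A - C)) A" | "z \<in> path_image f"
      | "z \<in> closed_segment (C + of_real c * (C - A)) C"
      using \<open>z \<in> path_image f'\<close> f'(4) by (auto simp: closed_segment_commute)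
    then show ?thesis
    proof cases
      case 1
      then obtain t where t: "0 \<le> t" "t \<le> a" "z = A + of_real t * (A - C)"
        using in_segment_beyond nonneg by metis
      have "t * (\<alpha> C - \<alpha> A) \<le> R + \<alpha> A" "t * (\<alpha> C - \<alpha> A) \<ge> 0"
        using mult_right_mono[OF t(2), of "\<alpha> C - \<alpha> A"] mult(1) signs t(1) by auto
      moreover have "\<alpha> z = \<alpha> A - t * (\<alpha> C - \<alpha> A)"
        unfolding t(3) aff by (simp add: algebra_simps)
      moreover have "\<beta> z = 0" unfolding t(3) aff using signs by simp
      moreover have "z \<notin> H \<or> z = A"
        using beyond_extreme_point[OF ext(1) inH(3) ne(1)] t by (cases "t = 0") auto
      moreover have "A \<in> path_image f" using f by auto
      ultimately show ?thesis using signs by auto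
    next
      case 3
      then obtain t where t: "0 \<le> t" "t \<le> c" "z = C + of_real t * (C - A)"
        using in_segment_beyond nonneg by metis
      have "t * (\<alpha> C - \<alpha> A) \<le> R - \<alpha> C" "t * (\<alpha> C - \<alpha> A) \<ge> 0"
        using mult_right_mono[OF t(2), of "\<alpha> C - \<alpha> A"] mult(2) signs t(1) by auto
      moreover have "\<alpha> z = \<alpha> C + t * (\<alpha> C - \<alpha> A)"
        unfolding t(3) aff by (simp add: algebra_simps)
      moreover have "\<beta> z = 0" unfolding t(3) aff using signs by simp
      moreover have "z \<notin> H \<or> z = C"
        using beyond_extreme_point[OF ext(3) inH(1)] ne t by (cases "t = 0") auto
      moreover have "C \<in> path_image f" using f by auto
      ultimately show ?thesis using signs by auto
    qed auto
  qed
  have g'_cases: "z \<in> path_image g \<or> z \<notin> H \<and> \<alpha> z = 0 \<and> \<beta> z \<noteq> 0 \<and> \<bar>\<beta> z\<bar> \<le> R"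
    if "z \<in> path_image g'" for z
  proof -
    consider "z \<in> closed_segment (B + of_real b * (B - D)) B" | "z \<in> path_image g"
      | "z \<in> closed_segment (D + of_real d * (D - B)) D"
      using \<open>z \<in> path_image g'\<close> g'(4) by (auto simp: closed_segment_commute)
    then show ?thesis
    proof cases
      case 1
      then obtain t where t: "0 \<le> t" "t \<le> b" "z = B + of_real t * (B - D)"
        using in_segment_beyond nonneg by metis
      have "t * (\<beta> D - \<beta> B) \<le> R + \<beta> B" "t * (\<beta> D - \<beta> B) \<ge> 0"
        using mult_right_mono[OF t(2), of "\<beta> D - \<beta> B"] mult(3) signs t(1) by auto
      moreover have "\<beta> z = \<beta> B - t * (\<beta> D - \<beta> B)"
        unfolding t(3) aff by (simp add: algebra_simps)
      moreover have "\<alpha> z = 0" unfolding t(3) aff using signs by simp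
      moreover have "z \<notin> H \<or> z = B"
        using beyond_extreme_point[OF ext(2) inH(4) ne(2)] t by (cases "t = 0") auto
      moreover have "B \<in> path_image g" using g by auto
      ultimately show ?thesis using signs by auto
    next
      case 3
      then obtain t where t: "0 \<le> t" "t \<le> d" "z = D + of_real t * (D - B)"
        using in_segment_beyond nonneg by metis
      have "t * (\<beta> D - \<beta> B) \<le> R - \<beta> D" "t * (\<beta> D - \<beta> B) \<ge> 0"
        using mult_right_mono[OF t(2), of "\<beta> D - \<beta> B"] mult(4) signs t(1) by auto
      moreover have "\<beta> z = \<beta> D + t * (\<beta> D - \<beta> B)"
        unfolding t(3) aff by (simp add: algebra_simps)
      moreover have "\<alpha> z = 0" unfolding t(3) aff using signs by simp
      moreover have "z \<notin> H \<or> z = D"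
        using beyond_extreme_point[OF ext(4) inH(2)] ne t by (cases "t = 0") auto
      moreover have "D \<in> path_image g" using g by auto
      ultimately show ?thesis using signs by auto
    qed auto
  qed
  have comp: "(\<psi> z) $ 1 = \<alpha> z" "(\<psi> z) $ 2 = \<beta> z" for z
    by (auto simp: \<psi>_def)
  have "continuous_on UNIV (\<lambda>z. if i = 1 then \<alpha> z else \<beta> z)" for i :: 2
    using cont by (cases "i = 1") auto
  then have "continuous_on UNIV \<psi>"
    unfolding \<psi>_def by (intro continuous_on_vec_lambda)
  let ?a = "vector [-R, -R] :: real^2" and ?b = "vector [R, R] :: real^2"
  have "path (\<psi> \<circ> f')" "path (\<psi> \<circ> g')"
    using \<open>continuous_on UNIV \<psi>\<close> f' g'
    by (auto intro!: path_continuous_image intro: continuous_on_subset)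
  moreover have "path_image (\<psi> \<circ> f') \<subseteq> cbox ?a ?b" "path_image (\<psi> \<circ> g') \<subseteq> cbox ?a ?b"
  proof -
    have box: "\<psi> z \<in> cbox ?a ?b" if "\<bar>\<alpha> z\<bar> \<le> R" "\<bar>\<beta> z\<bar> \<le> R" for z
      using that by (auto simp: mem_box_cart forall_2 comp abs_le_iff)
    have "R \<ge> 0" using R(1)[OF inH(1)] by linarith
    have "\<bar>\<alpha> z\<bar> \<le> R \<and> \<bar>\<beta> z\<bar> \<le> R" if "z \<in> path_image f'" for z
      using f'_cases[OF that]
    proof
      assume "z \<in> path_image f"
      then show ?thesis using R f(2) by blast
    qed (use \<open>R \<ge> 0\<close> in simp)
    moreover
    have "\<bar>\<alpha> z\<bar> \<le> R \<and> \<bar>\<beta> z\<bar> \<le> R" if "z \<in> path_image g'" for z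
      using g'_cases[OF that]
    proof
      assume "z \<in> path_image g"
      then show ?thesis using R g(2) by blast
    qed (use \<open>R \<ge> 0\<close> in simp)
    ultimately show "path_image (\<psi> \<circ> f') \<subseteq> cbox ?a ?b" "path_image (\<psi> \<circ> g') \<subseteq> cbox ?a ?b"
      using box by (auto simp: path_image_compose)
  qed
  moreover have "pathstart (\<psi> \<circ> f') $ 1 = ?a $ 1" "pathfinish (\<psi> \<circ> f') $ 1 = ?b $ 1"
    "pathstart (\<psi> \<circ> g') $ 2 = ?a $ 2" "pathfinish (\<psi> \<circ> g') $ 2 = ?b $ 2"
    unfolding pathstart_compose pathfinish_compose comp f'(2,3) g'(2,3) aff
    using mult by (simp_all add: algebra_simps)
  ultimately obtain y where "y \<in> path_image (\<psi> \<circ> f')" "y \<in> path_image (\<psi> \<circ> g')"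
    by (rule fashoda)
  then obtain z z' where z: "z \<in> path_image f'" "z' \<in> path_image g'" "\<psi> z = \<psi> z'"
    by (auto simp: path_image_compose)
  have "z = z'"
  proof -
    have "\<alpha> z = \<alpha> z'" "\<beta> z = \<beta> z'" using z(3) comp by metis+
    then have *: "(Re D - Re B) * (Im z - Im z') = (Im D - Im B) * (Re z - Re z')"
      "(Re C - Re A) * (Im z - Im z') = (Im C - Im A) * (Re z - Re z')"
      by (auto simp: \<alpha>_def \<beta>_def orient_def algebra_simps)
    \<comment> \<open>The determinant of the diagonals \<open>C - A\<close> and
      \<open>D - B\<close>. Cramer's rule then shows that the two coordinates determine the
      point.\<close>
    define \<Delta> where "\<Delta> = (Re C - Re A) * (Im D - Im B) - (Im C - Im A) * (Re D - Re B)"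
    have "\<Delta> = \<beta> D - \<beta> B" by (simp add: \<Delta>_def \<beta>_def orient_def algebra_simps)
    then have "\<Delta> \<noteq> 0" using signs by simp
    have "\<Delta> * (Im z - Im z') = (Im D - Im B) * ((Re C - Re A) * (Im z - Im z'))
        - (Im C - Im A) * ((Re D - Re B) * (Im z - Im z'))"
      by (simp add: \<Delta>_def algebra_simps)
    also have "\<dots> = 0" unfolding * by simp
    finally have "Im z = Im z'" using \<open>\<Delta> \<noteq> 0\<close> by simp
    moreover have "\<Delta> * (Re z - Re z') = (Re C - Re A) * ((Im D - Im B) * (Re z - Re z'))
        - (Re D - Re B) * ((Im C - Im A) * (Re z - Re z'))"
      by (simp add: \<Delta>_def algebra_simps)
    then have "\<Delta> * (Re z - Re z') = 0" unfolding *[symmetric] by simp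
    then have "Re z = Re z'" using \<open>\<Delta> \<noteq> 0\<close> by simp
    ultimately show ?thesis by (simp add: complex_eq_iff)
  qed
  then show ?thesis
    using f'_cases[OF z(1)] g'_cases[OF z(2)] f(2) g(2) by auto
qed

section \<open>Wheels in outer 1-planar graphs\<close>

definition convex_independent :: "complex set \<Rightarrow> bool" where
  "convex_independent K \<longleftrightarrow> (\<forall>x\<in>K. x \<notin> convex hull (K - {x}))"

lemma convex_independent_extreme_point:
  assumes "finite K" "convex_independent K" "x \<in> K"
  shows "x extreme_point_of (convex hull K)"
  using assms extreme_point_of_convex_hull_convex_independent[of K x]
  by (auto simp: convex_independent_def finite_imp_compact)

text \<open>Excludes two corners on one ray from a third corner, which later makes slopes
  injective.\<close>

lemma convex_independent_not_between:
  assumes "convex_independent K" "{a, b, w} \<subseteq> K" "b \<noteq> w" "b \<noteq> a"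
    "b = w + of_real s * (a - w)" "0 < s" "s < 1"
  shows False
proof -
  have "b = (1 - s) *\<^sub>R w + s *\<^sub>R a"
    using assms(5) by (simp add: complex_eq_iff algebra_simps)
  then have "b \<in> convex hull {w, a}"
    using assms(6,7) by (auto simp: convex_hull_2_alt algebra_simps intro!: exI[of _ s])
  also have "\<dots> \<subseteq> convex hull (K - {b})"
    using assms by (intro hull_mono) auto
  finally show False
    using assms by (auto simp: convex_independent_def)
qed

text \<open>
  By the hypotheses \<open>pos\<close>, \<open>b\<close> lies in the cone at \<open>w\<close> spanned by \<open>a\<close> and \<open>c\<close>. It is
  not in the triangle \<open>w a c\<close>, hence it lies beyond the line through \<open>a\<close> and \<open>c\<close>.
\<close>
lemma convex_independent_orient:
  assumes K: "convex_independent K" "{w, a, b, c} \<subseteq> K"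
    and pos: "orient w a b > 0" "orient w b c > 0" "orient w a c > 0"
  shows "orient a b c > 0"
proof (rule ccontr)
  assume "\<not> orient a b c > 0"
  define D where "D = orient w a c"
  \<comment> \<open>Barycentric coordinates of \<open>b\<close> with respect to \<open>w\<close>,
    \<open>a\<close>, \<open>c\<close>. The negated goal makes \<open>l\<close> nonnegative and so
    puts \<open>b\<close> into the triangle.\<close>
  define l m n where "l = - orient a b c / D" and "m = orient w b c / D" and "n = orient w a b / D"
  have D: "D > 0" using pos by (simp add: D_def)
  have nonneg: "l \<ge> 0" "m \<ge> 0" "n \<ge> 0"
    using pos D \<open>\<not> orient a b c > 0\<close>
    by (auto simp: l_def m_def n_def intro!: divide_nonpos_pos)
  have "D = - orient a b c + orient w b c + orient w a b"
    by (simp add: D_def orient_def algebra_simps)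
  moreover have "l + m + n = (- orient a b c + orient w b c + orient w a b) / D"
    by (simp add: l_def m_def n_def add_divide_distrib diff_divide_distrib)
  ultimately have sum: "l + m + n = 1"
    using D by (metis divide_self order_less_irrefl)
  have "D * Re b = - orient a b c * Re w + orient w b c * Re a + orient w a b * Re c"
    "D * Im b = - orient a b c * Im w + orient w b c * Im a + orient w a b * Im c"
    by (simp_all add: D_def orient_def algebra_simps)
  then have "Re b = (- orient a b c * Re w + orient w b c * Re a + orient w a b * Re c) / D"
    "Im b = (- orient a b c * Im w + orient w b c * Im a + orient w a b * Im c) / D"
    using D by (simp_all add: eq_divide_eq mult.commute)
  then have "b = l *\<^sub>R w + m *\<^sub>R a + n *\<^sub>R c"
    by (intro complex_eqI) (simp_all add: l_def m_def n_def add_divide_distrib diff_divide_distrib)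
  then have "b \<in> convex hull {w, a, c}"
    unfolding convex_hull_3 using nonneg sum by blast
  also have "\<dots> \<subseteq> convex hull (K - {b})"
    using K(2) pos by (intro hull_mono) (auto simp: orient_def)
  finally show False
    using K by (auto simp: convex_independent_def)
qed

text \<open>
  Since \<open>w\<close> is a corner, all the other points lie in an open half plane bounded by a line
  through \<open>w\<close>, so they are linearly ordered by the slope \<open>t\<close> of the ray from \<open>w\<close>.
\<close>
lemma convex_independent_slope:
  assumes fin: "finite K" and K: "convex_independent K" and w: "w \<in> K"
  obtains t :: "complex \<Rightarrow> real" where
    "inj_on t (K - {w})"
    "\<And>a b. a \<in> K - {w} \<Longrightarrow> b \<in> K - {w} \<Longrightarrow> t a < t b \<Longrightarrow> orient w a b > 0"
proof -
  have "closed (convex hull (K - {w}))"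
    using fin by (simp add: compact_convex_hull compact_imp_closed finite_imp_compact)
  moreover have "w \<notin> convex hull (K - {w})"
    using K w by (simp add: convex_independent_def)
  ultimately obtain h \<beta> where h: "inner h w < \<beta>" "\<forall>x\<in>convex hull (K - {w}). inner h x > \<beta>"
    using separating_hyperplane_closed_point[of "convex hull (K - {w})" w] by auto
  \<comment> \<open>Up to scaling, \<open>p\<close> and \<open>q\<close> are the coordinates, with
    origin \<open>w\<close>, along the normal \<open>h\<close> of a separating line and along
    \<open>h\<close> turned by a right angle.\<close>
  define p where "p x = Re h * (Re x - Re w) + Im h * (Im x - Im w)" for x
  define q where "q x = Re h * (Im x - Im w) - Im h * (Re x - Re w)" for x
  define t where "t x = q x / p x" for x
  have p: "p x > 0" if "x \<in> K - {w}" for x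
  proof -
    have "inner h x > \<beta>" using h(2) that by (simp add: hull_inc)
    then show ?thesis using h(1) by (simp add: p_def inner_complex_def algebra_simps)
  qed
  have h2: "(Re h)\<^sup>2 + (Im h)\<^sup>2 > 0" if "x \<in> K - {w}" for x
    using p[OF that] by (auto simp: p_def sum_power2_gt_zero_iff)
  have or: "((Re h)\<^sup>2 + (Im h)\<^sup>2) * orient w a b = p a * q b - q a * p b" for a b
    by (simp add: orient_def p_def q_def algebra_simps power2_eq_square)
  have less: "orient w a b > 0" if "a \<in> K - {w}" "b \<in> K - {w}" "t a < t b" for a b
  proof -
    have "p a * q b - q a * p b > 0"
      using that(3) p[OF that(1)] p[OF that(2)] by (simp add: t_def field_simps)
    then show ?thesis
      using or[of a b] h2[OF that(1)] by (metis zero_less_mult_pos)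
  qed
  \<comment> \<open>Equal slopes put both points on one ray from \<open>w\<close>, so the nearer one
    would lie between \<open>w\<close> and the other. By symmetry \<open>b\<close> is taken as the
    nearer one.\<close>
  have inj: "a = b" if ab: "a \<in> K - {w}" "b \<in> K - {w}" "t a = t b" "p b \<le> p a" for a b
  proof (rule ccontr)
    assume "a \<noteq> b"
    define s where "s = p b / p a"
    have pa: "p a > 0" "p b > 0" using p ab by auto
    have eq: "p b = s * p a" "q b = s * q a"
      using ab(3) pa by (auto simp: s_def t_def field_simps)
    define N where "N = (Re h)\<^sup>2 + (Im h)\<^sup>2"
    have coord: "N * (Re x - Re w) = Re h * p x - Im h * q x"
      "N * (Im x - Im w) = Im h * p x + Re h * q x" for x
      by (simp_all add: N_def p_def q_def algebra_simps power2_eq_square)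
    have "N * (Re b - Re w) = s * (N * (Re a - Re w))" "N * (Im b - Im w) = s * (N * (Im a - Im w))"
      unfolding coord eq by (simp_all add: algebra_simps)
    moreover have "N > 0" using h2[OF ab(1)] by (simp add: N_def)
    ultimately have "Re b - Re w = s * (Re a - Re w)" "Im b - Im w = s * (Im a - Im w)"
      by (simp_all add: mult.left_commute[of s])
    then have b: "b = w + of_real s * (a - w)"
      by (simp add: complex_eq_iff)
    have "s \<noteq> 1" using b \<open>a \<noteq> b\<close> by auto
    moreover have "0 < s" "s \<le> 1" using pa ab(4) by (auto simp: s_def)
    ultimately have "0 < s" "s < 1" by auto
    moreover have "{a, b, w} \<subseteq> K" "b \<noteq> w" "b \<noteq> a" using ab(1,2) w \<open>a \<noteq> b\<close> by auto
    ultimately show False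
      using convex_independent_not_between[OF K _ _ _ b] by blast
  qed
  have "inj_on t (K - {w})"
    by (rule inj_onI) (metis inj linear)
  with less that show thesis by blast
qed

text \<open>Interleaved edges meet, and having no common end point they cross properly there; an
  edge with two such partners would have two elements in \<open>crossings\<close>. From here on the
  curves are forgotten. Edges are compared as sets because the two quadrilaterals may list the ends
  of the common edge in either order.\<close>

lemma outer_1_planar_points:
  fixes G :: "('a, 'b) pre_digraph"
  assumes fin: "finite (verts G)" and "outer_1_planar G"
  obtains p where "inj_on p (verts G)" "convex_independent (p ` verts G)"
    "\<And>a b c d a' b' c' d'.
       {a, b, c, d} \<subseteq> verts G \<Longrightarrow> ccw_quad (p a) (p b) (p c) (p d) \<Longrightarrow>
       {a', b', c', d'} \<subseteq> verts G \<Longrightarrow> ccw_quad (p a') (p b') (p c') (p d') \<Longrightarrow>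
       {a, c} \<in> uedges G \<Longrightarrow> {b, d} \<in> uedges G \<Longrightarrow>
       {a', c'} \<in> uedges G \<Longrightarrow> {b', d'} \<in> uedges G \<Longrightarrow>
       {a, c} = {a', c'} \<Longrightarrow> {b, d} = {b', d'}"
proof -
  obtain p c where sd: "simple_drawing G p c" and cd: "convex_drawing G p c"
    and cr: "\<forall>e \<in> uedges G. finite (crossings G c e) \<and> card (crossings G c e) \<le> 1"
    using assms(2) by (auto simp: outer_1_planar_def)
  let ?K = "p ` verts G"
  have inj: "inj_on p (verts G)" using sd by (simp add: simple_drawing_def)
  have "p ` (verts G - {v}) = ?K - {p v}" if "v \<in> verts G" for v
    using inj that by (auto simp: inj_on_def)
  then have K: "convex_independent ?K"
    using cd by (auto simp: convex_drawing_def convex_independent_def)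
  have ext: "p v extreme_point_of convex hull ?K" if "v \<in> verts G" for v
    using convex_independent_extreme_point[OF _ K] fin that by simp
  \<comment> \<open>The curve of an edge may run in either direction; reversal makes it start at
    \<open>x\<close>.\<close>
  have path: "\<exists>f. path f \<and> path_image f = path_image (c {x, y}) \<and>
      pathstart f = p x \<and> pathfinish f = p y" if "{x, y} \<in> uedges G" for x y
  proof -
    have ce: "arc (c {x, y})" "{pathstart (c {x, y}), pathfinish (c {x, y})} = {p x, p y}"
      using sd that by (auto simp: simple_drawing_def)
    then consider "pathstart (c {x, y}) = p x" "pathfinish (c {x, y}) = p y"
      | "pathstart (c {x, y}) = p y" "pathfinish (c {x, y}) = p x"
      by (auto simp: doubleton_eq_iff)
    then show ?thesis
    proof cases
      case 1
      then show ?thesis using ce(1) arc_imp_path by blast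
    next
      case 2
      then show ?thesis using ce(1)
        by (intro exI[of _ "reversepath (c {x, y})"]) (auto simp: arc_imp_path)
    qed
  qed
  have crossing: "\<exists>x. ({v, y}, x) \<in> crossings G c {u, z}"
    if "{u, v, z, y} \<subseteq> verts G" "ccw_quad (p u) (p v) (p z) (p y)"
      "{u, z} \<in> uedges G" "{v, y} \<in> uedges G" for u v z y
  proof -
    note uedge = that(3,4)
    obtain f g where f: "path f" "path_image f = path_image (c {u, z})"
      "pathstart f = p u" "pathfinish f = p z"
      and g: "path g" "path_image g = path_image (c {v, y})"
      "pathstart g = p v" "pathfinish g = p y"
      using path uedge by metis
    have "path_image (c e) \<subseteq> convex hull ?K" if "e \<in> uedges G" for e
      using cd that by (auto simp: convex_drawing_def drawing_image_def)
    moreover have "bounded (convex hull ?K)"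
      using fin by (simp add: bounded_convex_hull finite_imp_bounded)
    ultimately have "path_image f \<inter> path_image g \<noteq> {}"
      using that f g by (intro crossing_paths_meet[where H = "convex hull ?K"]) (auto intro: ext)
    then obtain x where x: "x \<in> path_image (c {u, z}) \<inter> path_image (c {v, y})"
      using f g by auto
    have disj: "{u, z} \<inter> {v, y} = {}"
      using ccw_quad_distinct[OF that(2)] by auto
    then have ne: "{u, z} \<noteq> {v, y}" by auto
    have "x \<in> p ` ({u, z} \<inter> {v, y}) \<or>
        proper_crossing (path_image (c {u, z})) (path_image (c {v, y})) x"
      using sd[unfolded simple_drawing_def, THEN conjunct2, THEN conjunct2, rule_format,
          OF uedge ne, THEN conjunct1, THEN bspec, OF x] .
    then have "proper_crossing (path_image (c {u, z})) (path_image (c {v, y})) x"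
      unfolding disj by simp
    then show ?thesis
      using that(4) ne by (auto simp: crossings_def)
  qed
  have uniq: "X = Y" if "e \<in> uedges G" "(X, x) \<in> crossings G c e" "(Y, y) \<in> crossings G c e"
    for e X Y x y
    using cr that by (metis One_nat_def card_le_Suc0_iff_eq prod.inject)
  show thesis
  proof (rule that[OF inj K])
    fix u v z y u' v' z' y'
    assume *: "{u, v, z, y} \<subseteq> verts G" "ccw_quad (p u) (p v) (p z) (p y)"
      "{u', v', z', y'} \<subseteq> verts G" "ccw_quad (p u') (p v') (p z') (p y')"
      "{u, z} \<in> uedges G" "{v, y} \<in> uedges G" "{u', z'} \<in> uedges G" "{v', y'} \<in> uedges G"
      "{u, z} = {u', z'}"
    obtain x x' where "({v, y}, x) \<in> crossings G c {u, z}" "({v', y'}, x') \<in> crossings G c {u', z'}"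
      using crossing * by meson
    with * show "{v, y} = {v', y'}" using uniq by metis
  qed
qed

section \<open>The rim of a wheel in the order of slopes\<close>

lemma obtain_least:
  fixes t :: "'a \<Rightarrow> real"
  assumes "finite A" "A \<noteq> {}" "inj_on t A"
  obtains x where "x \<in> A" "\<And>y. y \<in> A - {x} \<Longrightarrow> t x < t y"
proof -
  obtain x where "x \<in> A" "\<forall>y\<in>A. t x \<le> t y"
    using arg_min_if_finite[of A t] assms by (metis linorder_not_less)
  with that assms(3) show thesis
    by (metis Diff_iff inj_on_eq_iff insertI1 order_le_less)
qed

text \<open>
  Order the rim by slope as seen from the hub \<open>w\<close>, with least elements \<open>u1 < u2 < u3\<close>. As the
  rim minus a vertex \<open>u\<close> is connected, some rim edge passes over \<open>u\<close> if \<open>u\<close> is not extremal, and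
  then it crosses the spoke at \<open>u\<close>. So the edge over \<open>u2\<close> is \<open>{u1, u3}\<close>, the edge over \<open>u3\<close>
  starts at \<open>u2\<close>, and these two edges cross.
\<close>
lemma outer_1_planar_no_wheel:
  fixes G :: "('a, 'b) pre_digraph"
  assumes fin: "finite (verts G)" and G: "outer_1_planar G"
    and R: "R \<subseteq> verts G" "4 \<le> card R" and w: "w \<in> verts G" "w \<notin> R"
    and hub: "\<And>u. u \<in> R \<Longrightarrow> {w, u} \<in> uedges G"
    and rim: "\<And>u A. u \<in> R \<Longrightarrow> A \<subset> R - {u} \<Longrightarrow> A \<noteq> {} \<Longrightarrow>
      \<exists>x\<in>A. \<exists>y\<in>R - {u} - A. {x, y} \<in> uedges G"
  shows False
proof -
  obtain p where p: "inj_on p (verts G)" "convex_independent (p ` verts G)" and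
    cross: "\<And>a b c d a' b' c' d'.
       {a, b, c, d} \<subseteq> verts G \<Longrightarrow> ccw_quad (p a) (p b) (p c) (p d) \<Longrightarrow>
       {a', b', c', d'} \<subseteq> verts G \<Longrightarrow> ccw_quad (p a') (p b') (p c') (p d') \<Longrightarrow>
       {a, c} \<in> uedges G \<Longrightarrow> {b, d} \<in> uedges G \<Longrightarrow>
       {a', c'} \<in> uedges G \<Longrightarrow> {b', d'} \<in> uedges G \<Longrightarrow>
       {a, c} = {a', c'} \<Longrightarrow> {b, d} = {b', d'}"
    using outer_1_planar_points[OF fin G] by metis
  obtain t' :: "complex \<Rightarrow> real" where t': "inj_on t' (p ` verts G - {p w})"
    "\<And>a b. a \<in> p ` verts G - {p w} \<Longrightarrow> b \<in> p ` verts G - {p w} \<Longrightarrow> t' a < t' b \<Longrightarrow>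
       orient (p w) a b > 0"
    using convex_independent_slope[of "p ` verts G" "p w"] fin p w by auto
  define t where "t u = t' (p u)" for u
  have mem: "p u \<in> p ` verts G - {p w}" if "u \<in> R" for u
    using that R(1) w p(1) by (auto simp: inj_on_def)
  have inj: "inj_on t R"
    using t'(1) mem p(1) R(1) unfolding t_def inj_on_def by (meson subsetD)
  have hub_pos: "orient (p w) (p a) (p b) > 0" if "a \<in> R" "b \<in> R" "t a < t b" for a b
    using t'(2) mem that by (simp add: t_def)
  have rim_pos: "orient (p a) (p b) (p c) > 0"
    if "a \<in> R" "b \<in> R" "c \<in> R" "t a < t b" "t b < t c" for a b c
  proof (rule convex_independent_orient[OF p(2), of "p w"])
    show "{p w, p a, p b, p c} \<subseteq> p ` verts G" using that R(1) w by auto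
  qed (use that hub_pos in auto)
  have hub_quad: "ccw_quad (p w) (p a) (p b) (p c)"
    if "a \<in> R" "b \<in> R" "c \<in> R" "t a < t b" "t b < t c" for a b c
    using that by (auto simp: ccw_quad_def hub_pos rim_pos)
  have rim_quad: "ccw_quad (p a) (p b) (p c) (p d)"
    if "a \<in> R" "b \<in> R" "c \<in> R" "d \<in> R" "t a < t b" "t b < t c" "t c < t d" for a b c d
    using that by (auto simp: ccw_quad_def rim_pos)
  \<comment> \<open>A rim edge over two rim vertices would cross the spokes of both.\<close>
  have no_two: False
    if "a \<in> R" "b \<in> R" "c \<in> R" "d \<in> R" "t a < t b" "t b < t c" "t c < t d"
      "{a, d} \<in> uedges G" for a b c d
  proof -
    have "ccw_quad (p a) (p b) (p d) (p w)" "ccw_quad (p a) (p c) (p d) (p w)"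
      using that hub_quad[of a b d] hub_quad[of a c d] by (auto intro: ccw_quad_rotate)
    moreover have "{b, w} \<in> uedges G" "{c, w} \<in> uedges G"
      using hub[of b] hub[of c] that by (auto simp: insert_commute)
    ultimately have "{b, w} = {c, w}"
      using cross[of a b d w a c d w] that R(1) w(1) by auto
    with that show False by (auto simp: doubleton_eq_iff)
  qed
  have finR: "finite R" using R(2) by (metis card.infinite not_numeral_le_zero)
  have "R \<noteq> {}" using R(2) by auto
  obtain u1 where u1: "u1 \<in> R" "\<And>y. y \<in> R - {u1} \<Longrightarrow> t u1 < t y"
    using obtain_least[OF finR \<open>R \<noteq> {}\<close> inj] by blast
  have "R - {u1} \<noteq> {}" "R - {u1} - {u2} \<noteq> {}" "R - {u1} - {u2} - {u3} \<noteq> {}" for u2 u3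
  proof -
    have "card R \<le> card {u1, u2, u3}" if "R \<subseteq> {u1, u2, u3}"
      using card_mono[OF _ that] by simp
    moreover have "card {u1, u2, u3} \<le> 3" by (simp add: card_insert_if)
    ultimately have "\<not> R \<subseteq> {u1, u2, u3}" using R(2) by linarith
    then show "R - {u1} \<noteq> {}" "R - {u1} - {u2} \<noteq> {}" "R - {u1} - {u2} - {u3} \<noteq> {}"
      by auto
  qed
  note ne = this
  obtain u2 where u2: "u2 \<in> R - {u1}" "\<And>y. y \<in> R - {u1} - {u2} \<Longrightarrow> t u2 < t y"
    using obtain_least[of "R - {u1}" t] finR ne(1) inj_on_diff[OF inj] by blast
  obtain u3 where u3: "u3 \<in> R - {u1} - {u2}" "\<And>y. y \<in> R - {u1} - {u2} - {u3} \<Longrightarrow> t u3 < t y"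
    using obtain_least[of "R - {u1} - {u2}" t] finR ne(2) inj_on_diff[OF inj_on_diff[OF inj]]
    by blast
  have less: "t u1 < t u2" "t u2 < t u3" using u1 u2 u3 by auto
  have "\<exists>x\<in>{u1}. \<exists>y\<in>R - {u2} - {u1}. {x, y} \<in> uedges G"
    using u1 u2 u3 by (intro rim) auto
  then obtain y where y: "y \<in> R - {u1} - {u2}" "{u1, y} \<in> uedges G" by auto
  have "y = u3"
  proof (rule ccontr)
    assume "y \<noteq> u3"
    then have "t u3 < t y" using u3(2)[of y] y(1) by simp
    then show False using no_two[of u1 u2 u3 y] less u1(1) u2(1) u3(1) y by simp
  qed
  obtain r where r: "r \<in> R - {u1} - {u2} - {u3}" using ne(3) by blast
  have "{u1, u2} \<subset> R - {u3}" using r u1(1) u2(1) u3(1) by blast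
  \<comment> \<open>With \<open>u3\<close> deleted, \<open>{u1, u2}\<close> is joined to some
    \<open>z\<close> beyond \<open>u3\<close>; a fourth rim vertex makes this a proper cut. An edge
    from \<open>u1\<close> to \<open>z\<close> would pass over both \<open>u2\<close> and
    \<open>u3\<close>, so the edge starts at \<open>u2\<close>.\<close>
  then have "\<exists>x\<in>{u1, u2}. \<exists>y\<in>R - {u3} - {u1, u2}. {x, y} \<in> uedges G"
    using u3(1) by (intro rim) auto
  then obtain x z where z: "x \<in> {u1, u2}" "z \<in> R - {u1} - {u2} - {u3}" "{x, z} \<in> uedges G"
    by blast
  have "t u3 < t z" using u3(2) z(2) by blast
  have "x = u2"
    using no_two[of u1 u2 u3 z] less \<open>t u3 < t z\<close> u1(1) u2(1) u3(1) z by auto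
  \<comment> \<open>The contradiction: \<open>{u1, u3}\<close> is crossed both by
    \<open>{u2, z}\<close> and by the spoke at \<open>u2\<close>.\<close>
  have "ccw_quad (p u1) (p u2) (p u3) (p z)" "ccw_quad (p u1) (p u2) (p u3) (p w)"
    using u1(1) u2(1) u3(1) z(2) less \<open>t u3 < t z\<close> rim_quad[of u1 u2 u3 z]
      ccw_quad_rotate[OF hub_quad[of u1 u2 u3]] by auto
  moreover have "{u2, w} \<in> uedges G" using hub[of u2] u2(1) by (simp add: insert_commute)
  moreover have "{u1, u2, u3, z} \<subseteq> verts G" "{u1, u2, u3, w} \<subseteq> verts G"
    using u1(1) u2(1) u3(1) z(2) R(1) w(1) by blast+
  moreover have "{u1, u3} \<in> uedges G" "{u2, z} \<in> uedges G"
    using y(2) z(3) \<open>x = u2\<close> \<open>y = u3\<close> by simp_all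
  ultimately have "{u2, z} = {u2, w}"
    using cross[of u1 u2 u3 z u1 u2 u3 w] by blast
  then show False
    using z(2) w(2) by (auto simp: doubleton_eq_iff)
qed

section \<open>Holes, simplicial vertices and corners\<close>

text \<open>Adjacency is detached from the graph, so that induced subgraphs are plain vertex sets
  and deleting a vertex is \<open>S - {v}\<close>.\<close>

locale sym_irrefl =
  fixes E :: "'a \<Rightarrow> 'a \<Rightarrow> bool"
  assumes sym: "E x y \<Longrightarrow> E y x" and irrefl: "\<not> E x x"
begin

definition hole :: "'a list \<Rightarrow> bool" where
  "hole vs \<longleftrightarrow> 4 \<le> length vs \<and> distinct vs \<and>
    (\<forall>i < length vs. \<forall>j < length vs.
       E (vs ! i) (vs ! j) \<longleftrightarrow> j = Suc i mod length vs \<or> i = Suc j mod length vs)"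

definition chordal_on :: "'a set \<Rightarrow> bool" where
  "chordal_on S \<longleftrightarrow> \<not> (\<exists>vs. hole vs \<and> set vs \<subseteq> S)"

definition induced_path :: "'a list \<Rightarrow> bool" where
  "induced_path ps \<longleftrightarrow> distinct ps \<and>
    (\<forall>i < length ps. \<forall>j < length ps. E (ps ! i) (ps ! j) \<longleftrightarrow> j = Suc i \<or> i = Suc j)"

definition simplicial :: "'a set \<Rightarrow> 'a \<Rightarrow> bool" where
  "simplicial S v \<longleftrightarrow> v \<in> S \<and> (\<forall>x\<in>S. \<forall>y\<in>S. E v x \<longrightarrow> E v y \<longrightarrow> x \<noteq> y \<longrightarrow> E x y)"

text \<open>Domination of closed neighbourhoods within \<open>S\<close>: exactly what makes folding
  \<open>v\<close> onto \<open>w\<close> a retraction of the graph induced on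
  \<open>S\<close>.\<close>

definition corner :: "'a set \<Rightarrow> 'a \<Rightarrow> 'a \<Rightarrow> bool" where
  "corner S v w \<longleftrightarrow> v \<in> S \<and> w \<in> S \<and> E v w \<and> (\<forall>x\<in>S. E v x \<longrightarrow> x = w \<or> E w x)"

text \<open>Connectivity by cuts rather than by walks: this is the form in which the wheel argument
  asks for rim edges, and it makes deleting a corner easy.\<close>

definition connected_on :: "'a set \<Rightarrow> bool" where
  "connected_on S \<longleftrightarrow> (\<forall>A. A \<subset> S \<longrightarrow> A \<noteq> {} \<longrightarrow> (\<exists>x\<in>A. \<exists>y\<in>S - A. E x y))"

section \<open>Holes cut open and shortest walks\<close>

lemma chordal_on_subset: "chordal_on S \<Longrightarrow> T \<subseteq> S \<Longrightarrow> chordal_on T"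
  unfolding chordal_on_def by (meson order_trans)

text \<open>Trades the cyclic indices of \<open>hole\<close> for the linear ones of
  \<open>induced_path\<close>. Holes are built and taken apart in this form below.\<close>

lemma hole_Cons:
  "hole (w # ps) \<longleftrightarrow> 3 \<le> length ps \<and> w \<notin> set ps \<and> induced_path ps \<and>
     (\<forall>i < length ps. E w (ps ! i) \<longleftrightarrow> i = 0 \<or> Suc i = length ps)"
  (is "?L \<longleftrightarrow> ?R")
proof (cases "3 \<le> length ps")
  case True
  define n where "n = length ps"
  have n: "n \<ge> 3" using True by (simp add: n_def)
  have m: "Suc (Suc i) mod Suc n = (if Suc i = n then 0 else Suc (Suc i))" if "i < n" for i
    using that by simp
  have m0: "Suc 0 mod Suc n = Suc 0" using n by simp
  have 1: "(\<forall>i<Suc n. \<forall>j<Suc n. E ((w # ps) ! i) ((w # ps) ! j) \<longleftrightarrow>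
        j = Suc i mod Suc n \<or> i = Suc j mod Suc n) \<longleftrightarrow>
     (\<forall>i<n. E w (ps ! i) \<longleftrightarrow> i = 0 \<or> Suc i = n) \<and>
     (\<forall>i<n. E (ps ! i) w \<longleftrightarrow> i = 0 \<or> Suc i = n) \<and>
     (\<forall>i<n. \<forall>j<n. E (ps ! i) (ps ! j) \<longleftrightarrow> j = Suc i \<or> i = Suc j)"
    (is "?A \<longleftrightarrow> ?B1 \<and> ?B2 \<and> ?B3")
    using n unfolding All_less_Suc2
    by (auto simp: m m0 irrefl simp del: mod_Suc_Suc_eq mod_less) 
  have "?B1 \<longleftrightarrow> ?B2" using sym by metis
  with 1 show ?thesis
    using True unfolding hole_def induced_path_def n_def by auto
qed (auto simp: hole_def)

text \<open>Shifting both indices by \<open>m\<close> modulo the length preserves the cyclic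
  successor relation, since \<open>m\<close> cancels in the congruence.\<close>

lemma hole_rotate:
  assumes "hole vs"
  shows "hole (rotate m vs)"
proof -
  define n where "n = length vs"
  have n: "n > 0" using assms by (auto simp: hole_def n_def)
  have step: "(m + j) mod n = Suc ((m + i) mod n) mod n \<longleftrightarrow> j = Suc i mod n"
    if "i < n" "j < n" for i j
  proof -
    have "Suc ((m + i) mod n) mod n = (m + Suc i) mod n" by (simp add: mod_Suc_eq)
    then have "(m + j) mod n = Suc ((m + i) mod n) mod n \<longleftrightarrow> [m + j = m + Suc i] (mod n)"
      by (simp add: cong_def)
    also have "\<dots> \<longleftrightarrow> [j = Suc i] (mod n)" by (rule cong_add_lcancel_nat)
    finally show ?thesis using that by (simp add: cong_def)
  qed
  have "E (rotate m vs ! i) (rotate m vs ! j) \<longleftrightarrow> j = Suc i mod n \<or> i = Suc j mod n"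
    if "i < n" "j < n" for i j
    using assms that n step[OF that] step[OF that(2,1)]
    by (auto simp: nth_rotate hole_def n_def[symmetric])
  then show ?thesis
    using assms by (auto simp: hole_def n_def)
qed

lemma hole_rotate_to:
  assumes "hole vs" "v \<in> set vs"
  obtains ps where "hole (v # ps)" "set vs = insert v (set ps)"
proof -
  obtain m where m: "m < length vs" "v = vs ! m"
    using assms(2) by (metis in_set_conv_nth)
  have "rotate m vs \<noteq> []" "hd (rotate m vs) = v"
    using m by (cases vs; auto simp: hd_rotate_conv_nth)+
  then have "rotate m vs = v # tl (rotate m vs)" by (metis list.collapse)
  with that hole_rotate[OF assms(1), of m] show thesis
    by (metis list.simps(15) set_rotate)
qed

text \<open>A shortest walk from \<open>x\<close> to \<open>y\<close> in \<open>U\<close> works, as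
  a chord or a repeated vertex would allow a shortcut.\<close>

lemma walk_imp_induced_path:
  assumes "(\<lambda>a b. E a b \<and> a \<in> U \<and> b \<in> U)\<^sup>*\<^sup>* x y" "x \<in> U"
  obtains ps where "induced_path ps" "ps \<noteq> []" "hd ps = x" "last ps = y" "set ps \<subseteq> U"
proof -
  define W where "W ps \<longleftrightarrow> ps \<noteq> [] \<and> hd ps = x \<and> last ps = y \<and> set ps \<subseteq> U \<and>
    successively E ps" for ps
  have "\<exists>ps. W ps"
    unfolding W_def using assms(1)
  proof (induction rule: rtranclp_induct)
    case base
    show ?case using assms(2) by (intro exI[of _ "[x]"]) auto
  next
    case (step y z)
    then obtain ps where ps: "ps \<noteq> []" "hd ps = x" "last ps = y" "set ps \<subseteq> U" "successively E ps"
      by blast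
    then show ?case using step(2)
      by (intro exI[of _ "ps @ [z]"]) (auto simp: successively_append_iff)
  qed
  then obtain ps where ps: "W ps" and min: "\<And>qs. W qs \<Longrightarrow> length ps \<le> length qs"
    using ex_has_least_nat[of W _ length] by blast
  note ps' = ps[unfolded W_def]
  define n where "n = length ps"
  have "n > 0" using ps' by (simp add: n_def)
  have edge: "E (ps ! i) (ps ! Suc i)" if "Suc i < n" for i
    using ps' that by (simp add: successively_conv_nth n_def)
  have tk: "successively E (take k ps)" "successively E (drop k ps)" for k
    using edge by (auto simp: successively_conv_nth n_def)
  have last_take: "last (take (Suc i) ps) = ps ! i" if "i < n" for i
    using that by (simp add: take_Suc_conv_app_nth n_def)
  have no_chord: False if "Suc i < k" "k < n" "E (ps ! i) (ps ! k)" for i k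
  proof -
    let ?qs = "take (Suc i) ps @ drop k ps"
    have "successively E ?qs"
      using that tk by (auto simp: successively_append_iff last_take hd_drop_conv_nth n_def[symmetric])
    then have "W ?qs"
      using ps' that set_take_subset[of "Suc i" ps] set_drop_subset[of k ps]
      by (auto simp: W_def n_def)
    from min[OF this] that show False by (simp add: n_def)
  qed
  \<comment> \<open>A repetition at the very end allows the walk to stop earlier. Any other
    repetition yields a chord from the first occurrence to the successor of the second.\<close>
  have no_rep: False if "i < j" "j < n" "ps ! i = ps ! j" for i j
  proof (cases "Suc j = n")
    case True
    let ?qs = "take (Suc i) ps"
    have "last ?qs = ps ! i" using that by (simp add: last_take)
    moreover have "last ps = ps ! j"
      using ps' True by (metis diff_Suc_1 last_conv_nth n_def)
    ultimately have "W ?qs"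
      using ps' that tk set_take_subset[of "Suc i" ps] by (auto simp: W_def)
    from min[OF this] that show False by (simp add: n_def)
  next
    case False
    then show False using no_chord[of i "Suc j"] edge[of j] that by auto
  qed
  have "distinct ps"
    unfolding distinct_conv_nth n_def[symmetric] using no_rep by (metis linorder_neqE_nat)
  moreover have "E (ps ! i) (ps ! j) \<longleftrightarrow> j = Suc i \<or> i = Suc j" if "i < n" "j < n" for i j
  proof
    assume "E (ps ! i) (ps ! j)"
    then show "j = Suc i \<or> i = Suc j"
      using no_chord[of i j] no_chord[of j i] that sym irrefl
      by (metis Suc_lessI linorder_neqE_nat)
  next
    assume "j = Suc i \<or> i = Suc j"
    then show "E (ps ! i) (ps ! j)" using edge sym that by blast
  qed
  ultimately have "induced_path ps" by (simp add: induced_path_def n_def)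
  with that ps' show thesis by blast
qed

text \<open>
  The induction, on the size of \<open>S\<close>, runs over the graph induced on a component \<open>A\<close> of the
  non-neighbours of \<open>v\<close> and the set \<open>T\<close> of its neighbours. The set \<open>T\<close> is a clique:
  otherwise a shortest path through \<open>A\<close> between two of its members closes up with \<open>v\<close> to a hole.
\<close>
lemma chordal_on_imp_simplicial_nonneighbour:
  assumes "finite S" "chordal_on S" "v \<in> S" "u \<in> S" "u \<noteq> v" "\<not> E v u"
  shows "\<exists>z\<in>S. z \<noteq> v \<and> \<not> E v z \<and> simplicial S z"
  using assms
proof (induction S arbitrary: v u rule: finite_psubset_induct)
  case (psubset S)
  define U where "U = {z \<in> S. z \<noteq> v \<and> \<not> E v z}"
  define A where "A = {z. (\<lambda>a b. E a b \<and> a \<in> U \<and> b \<in> U)\<^sup>*\<^sup>* u z}"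
  define T where "T = {t \<in> S - A. \<exists>a\<in>A. E t a}"
  have u: "u \<in> U" "u \<in> A" using psubset.prems by (auto simp: U_def A_def)
  have AU: "A \<subseteq> U"
  proof
    fix z assume "z \<in> A"
    then have "(\<lambda>a b. E a b \<and> a \<in> U \<and> b \<in> U)\<^sup>*\<^sup>* u z" by (simp add: A_def)
    then show "z \<in> U" by (cases rule: rtranclp.cases) (use u in auto)
  qed
  have closed: "b \<in> A" if "a \<in> A" "E a b" "b \<in> U" for a b
    using that AU by (auto simp: A_def intro: rtranclp.rtrancl_into_rtrancl)
  \<comment> \<open>Otherwise \<open>t\<close> would lie in \<open>U\<close> next to
    \<open>A\<close>, and hence in the component itself.\<close>
  have Tv: "E v t" if t: "t \<in> T" for t
  proof -
    obtain a where a: "a \<in> A" "E t a" using t by (auto simp: T_def)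
    have "t \<notin> U" using closed[OF a(1) sym[OF a(2)]] t by (auto simp: T_def)
    moreover have "t \<noteq> v" using a AU by (auto simp: U_def)
    ultimately show ?thesis using t by (auto simp: T_def U_def)
  qed
  have clique: "E x y" if xy: "x \<in> T" "y \<in> T" "x \<noteq> y" for x y
  proof (rule ccontr)
    assume nE: "\<not> E x y"
    let ?U = "A \<union> {x, y}"
    define R where "R = (\<lambda>a b. E a b \<and> a \<in> ?U \<and> b \<in> ?U)"
    have reach: "R\<^sup>*\<^sup>* u z \<and> z \<in> A" if "z \<in> A" for z
    proof -
      have "(\<lambda>a b. E a b \<and> a \<in> U \<and> b \<in> U)\<^sup>*\<^sup>* u z" using that by (simp add: A_def)
      then show ?thesis
      proof (induction rule: rtranclp_induct)
        case base
        then show ?case using u by auto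
      next
        case (step b c)
        then have "c \<in> A" using closed by blast
        moreover have "R b c" using step \<open>c \<in> A\<close> by (auto simp: R_def)
        ultimately show ?case using step.IH rtranclp.rtrancl_into_rtrancl[of R u b c] by blast
      qed
    qed
    have "symp R" using sym by (auto simp: R_def intro!: sympI)
    then have symR: "symp R\<^sup>*\<^sup>*" by (rule symp_rtranclp)
    obtain a b where ab: "a \<in> A" "E x a" "b \<in> A" "E y b" using xy by (auto simp: T_def)
    have "R\<^sup>*\<^sup>* u a" "R\<^sup>*\<^sup>* u b" using reach ab by auto
    moreover have "R a x" "R b y" using ab sym by (auto simp: R_def)
    ultimately have "R\<^sup>*\<^sup>* u x" "R\<^sup>*\<^sup>* u y"
      using rtranclp.rtrancl_into_rtrancl[of R u] by blast+
    then have "R\<^sup>*\<^sup>* x y" using symR rtranclp_trans[of R x u y] by (blast dest: sympD)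
    then obtain ps where ps: "induced_path ps" "ps \<noteq> []" "hd ps = x" "last ps = y" "set ps \<subseteq> ?U"
      using walk_imp_induced_path[of ?U x y] unfolding R_def by blast
    define n where "n = length ps"
    have n: "n > 0" using ps by (simp add: n_def)
    have ends: "ps ! 0 = x" "ps ! (n - 1) = y"
      using ps by (auto simp: hd_conv_nth last_conv_nth n_def)
    have "n \<noteq> 1" using ends xy(3) by auto
    moreover have "n \<noteq> 2"
    proof
      assume "n = 2"
      then have "E (ps ! 0) (ps ! 1)" using ps(1) by (simp add: induced_path_def n_def)
      with ends nE \<open>n = 2\<close> show False by simp
    qed
    ultimately have "3 \<le> n" using n by linarith
    then have "3 \<le> length ps" by (simp add: n_def)
    moreover have "v \<notin> set ps"
      using ps(5) AU Tv[OF xy(1)] Tv[OF xy(2)] irrefl by (auto simp: U_def)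
    moreover have "E v (ps ! i) \<longleftrightarrow> i = 0 \<or> Suc i = n" if "i < n" for i
    proof
      assume "E v (ps ! i)"
      then have "ps ! i \<notin> A" using AU by (auto simp: U_def)
      then have "ps ! i = x \<or> ps ! i = y" using ps(5) that by (auto simp: n_def dest: nth_mem)
      then show "i = 0 \<or> Suc i = n"
        using ends ps(1) that n unfolding induced_path_def
        by (metis Suc_diff_1 diff_less less_numeral_extra(1) n_def nth_eq_iff_index_eq)
    next
      assume "i = 0 \<or> Suc i = n"
      then show "E v (ps ! i)" using ends Tv xy by auto
    qed
    ultimately have "hole (v # ps)" using ps(1) by (simp add: hole_Cons n_def)
    moreover have "set (v # ps) \<subseteq> S"
      using ps(5) AU xy psubset.prems by (auto simp: U_def T_def)
    ultimately show False using psubset.prems unfolding chordal_on_def by blast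
  qed
  define S' where "S' = A \<union> T"
  have S': "S' \<subset> S"
  proof
    show "S' \<subseteq> S" using AU by (auto simp: S'_def U_def T_def)
    have "v \<notin> S'" using AU Tv irrefl by (auto simp: S'_def U_def)
    then show "S' \<noteq> S" using psubset.prems by auto
  qed
  have ch: "chordal_on S'" using psubset.prems S' by (auto intro: chordal_on_subset)
  \<comment> \<open>A vertex of \<open>A\<close> has all its neighbours within \<open>S'\<close>, so
    being simplicial there is the same as in \<open>S\<close>.\<close>
  have lift: "simplicial S z" if "simplicial S' z" "z \<in> A" for z
  proof -
    have "x \<in> S'" if "x \<in> S" "E z x" for x
      using that \<open>z \<in> A\<close> sym[of z x] by (auto simp: S'_def T_def)
    moreover have "z \<in> S" using \<open>z \<in> A\<close> AU by (auto simp: U_def)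
    ultimately show ?thesis using \<open>simplicial S' z\<close> unfolding simplicial_def by blast
  qed
  \<comment> \<open>The induction hypothesis is applied at a vertex of \<open>T\<close> with a
    non-neighbour in \<open>S'\<close>, if there is one; the result avoids \<open>T\<close> because
    \<open>T\<close> is a clique. Failing that, it is applied at such a vertex of \<open>A\<close>;
    the result avoids \<open>T\<close> because every vertex of \<open>T\<close> now sees all of
    \<open>S'\<close>. If neither exists, \<open>S'\<close> is complete.\<close>
  have "\<exists>z\<in>A. simplicial S' z"
  proof (cases "\<exists>t\<in>T. \<exists>s\<in>S'. s \<noteq> t \<and> \<not> E t s")
    case True
    then obtain t s where "t \<in> T" "s \<in> S'" "s \<noteq> t" "\<not> E t s" by blast
    then show ?thesis
      using psubset.IH[OF S' ch, of t s] clique by (auto simp: S'_def)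
  next
    case False
    show ?thesis
    proof (cases "\<exists>a\<in>A. \<exists>s\<in>S'. s \<noteq> a \<and> \<not> E a s")
      case True
      then obtain a s where as: "a \<in> A" "s \<in> S'" "s \<noteq> a" "\<not> E a s" by blast
      then have "a \<in> S'" by (simp add: S'_def)
      then obtain z where z: "z \<in> S'" "z \<noteq> a" "\<not> E a z" "simplicial S' z"
        using psubset.IH[OF S' ch _ as(2-4)] by blast
      have "z \<notin> T"
      proof
        assume "z \<in> T"
        then have "E z a" using False \<open>a \<in> S'\<close> z(2) by metis
        then show False using sym z(3) by blast
      qed
      then have "z \<in> A" using z(1) by (simp add: S'_def)
      with z(4) show ?thesis by blast
    next
      case nA: False
      have "E x y" if "x \<in> S'" "y \<in> S'" "x \<noteq> y" for x y
      proof (cases "x \<in> A")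
        case True
        with nA that(2,3) show ?thesis by metis
      next
        case xA: False
        then have "x \<in> T" using that(1) by (simp add: S'_def)
        with False that(2,3) show ?thesis by metis
      qed
      then have "simplicial S' u"
        using u(2) by (simp add: simplicial_def S'_def)
      with u show ?thesis by blast
    qed
  qed
  then obtain z where z: "z \<in> A" "simplicial S' z" by blast
  then have "z \<in> U" using AU by blast
  then show ?case using lift[OF z(2,1)] by (auto simp: U_def)
qed

section \<open>Simplicial vertices, corners and fans\<close>

lemma chordal_on_imp_simplicial:
  assumes "finite S" "chordal_on S" "S \<noteq> {}"
  shows "\<exists>z. simplicial S z"
proof (cases "\<exists>v\<in>S. \<exists>u\<in>S. u \<noteq> v \<and> \<not> E v u")
  case True
  then show ?thesis using chordal_on_imp_simplicial_nonneighbour assms by blast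
next
  case False
  moreover obtain z where "z \<in> S" using assms(3) by blast
  ultimately have "simplicial S z" unfolding simplicial_def by metis
  then show ?thesis ..
qed

text \<open>Put \<open>v\<close> on the side of the cut that contains \<open>w\<close>: a cut edge
  starting at \<open>v\<close> can then start at \<open>w\<close> instead. If \<open>w\<close> is
  not in \<open>A\<close>, the argument is applied to the complement of \<open>A\<close>.\<close>

lemma connected_on_remove_corner:
  assumes S: "connected_on S" and c: "corner S v w"
  shows "connected_on (S - {v})"
  unfolding connected_on_def
proof (intro allI impI)
  fix A assume A: "A \<subset> S - {v}" "A \<noteq> {}"
  have *: "\<exists>x\<in>B. \<exists>y\<in>S - {v} - B. E x y" if B: "B \<subset> S - {v}" "w \<in> B" for B
  proof -
    have "insert v B \<subset> S" using B c by (auto simp: corner_def)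
    then obtain x y where xy: "x \<in> insert v B" "y \<in> S - insert v B" "E x y"
      using S unfolding connected_on_def by (meson insert_not_empty)
    then have "x = v \<Longrightarrow> E w y" using c B unfolding corner_def by auto
    with xy B show ?thesis by blast
  qed
  show "\<exists>x\<in>A. \<exists>y\<in>S - {v} - A. E x y"
  proof (cases "w \<in> A")
    case False
    then have "w \<in> S - {v} - A" using c irrefl by (auto simp: corner_def)
    moreover have "S - {v} - A \<subset> S - {v}" using A by auto
    ultimately show ?thesis using *[of "S - {v} - A"] sym A by blast
  qed (use * A in blast)
qed

lemma chordal_on_imp_corner:
  assumes "finite S" "chordal_on S" "connected_on S" "2 \<le> card S"
  obtains v w where "corner S v w"
proof -
  obtain v where v: "simplicial S v"
    using chordal_on_imp_simplicial assms by fastforce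
  have "{v} \<subset> S" using v assms(4) by (auto simp: simplicial_def)
  then obtain w where "w \<in> S" "E v w" using assms(3) unfolding connected_on_def by blast
  with v have "corner S v w" by (auto simp: corner_def simplicial_def)
  with that show thesis .
qed

text \<open>If \<open>w\<close> missed \<open>x\<close>, then the stretch of the path from the last
  neighbour of \<open>w\<close> before \<open>x\<close> to the first one after \<open>x\<close>
  would close up with \<open>w\<close> to a hole.\<close>

lemma chordal_on_fan:
  assumes S: "chordal_on S" and ps: "induced_path ps" "set ps \<subseteq> S" "ps \<noteq> []"
    and w: "w \<in> S" "w \<notin> set ps" "E w (hd ps)" "E w (last ps)" and x: "x \<in> set ps"
  shows "E w x"
proof (rule ccontr)
  assume "\<not> E w x"
  define n where "n = length ps"
  obtain i where i: "i < n" "x = ps ! i" using x by (auto simp: in_set_conv_nth n_def)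
  have ends: "E w (ps ! 0)" "E w (ps ! (n - 1))"
    using w ps(3) by (auto simp: hd_conv_nth last_conv_nth n_def)
  define J L where "J = {j. j < i \<and> E w (ps ! j)}" and "L = (\<lambda>l. i < l \<and> l < n \<and> E w (ps ! l))"
  have "i \<noteq> 0" "i \<noteq> n - 1" using ends i \<open>\<not> E w x\<close> by metis+
  then have "0 \<in> J" "L (n - 1)" using ends i by (auto simp: J_def L_def)
  define j l where "j = Max J" and "l = (LEAST l. L l)"
  have "finite J" by (auto simp: J_def)
  then have "j \<in> J" and jmax: "\<And>k. k \<in> J \<Longrightarrow> k \<le> j"
    using \<open>0 \<in> J\<close> Max_in[of J] by (auto simp only: j_def Max_ge)
  have "L l" and lmin: "\<And>k. L k \<Longrightarrow> l \<le> k"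
    using LeastI[of L, OF \<open>L (n - 1)\<close>] Least_le[of L] by (auto simp: l_def)
  have jl: "j < i" "i < l" "l < n" "E w (ps ! j)" "E w (ps ! l)"
    using \<open>j \<in> J\<close> \<open>L l\<close> by (auto simp: J_def L_def)
  define qs where "qs = take (Suc (l - j)) (drop j ps)"
  have len: "length qs = Suc (l - j)" using jl by (simp add: qs_def n_def)
  have nth: "qs ! k = ps ! (j + k)" if "k < Suc (l - j)" for k
    using that jl by (simp add: qs_def n_def)
  have sub: "set qs \<subseteq> set ps"
    unfolding qs_def by (meson order_trans set_drop_subset set_take_subset)
  have "induced_path qs"
    unfolding induced_path_def len
  proof (intro conjI allI impI)
    show "distinct qs" using ps(1) by (simp add: qs_def induced_path_def)
    fix a b assume "a < Suc (l - j)" "b < Suc (l - j)"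
    then show "E (qs ! a) (qs ! b) \<longleftrightarrow> b = Suc a \<or> a = Suc b"
      using ps(1) jl by (auto simp: nth induced_path_def n_def[symmetric])
  qed
  moreover have "E w (qs ! k) \<longleftrightarrow> k = 0 \<or> Suc k = length qs" if k: "k < length qs" for k
  proof
    assume E: "E w (qs ! k)"
    show "k = 0 \<or> Suc k = length qs"
    proof (rule ccontr)
      assume "\<not> (k = 0 \<or> Suc k = length qs)"
      then have k': "0 < k" "j + k < l" using k len by auto
      have E': "E w (ps ! (j + k))" using E k nth len by simp
      have "j + k \<notin> J" using jmax[of "j + k"] k' by auto
      moreover have "\<not> L (j + k)" using lmin[of "j + k"] k' by auto
      ultimately have "j + k = i" using E' k' jl by (auto simp: J_def L_def)
      then show False using E' i \<open>\<not> E w x\<close> by simp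
    qed
  next
    assume "k = 0 \<or> Suc k = length qs"
    then show "E w (qs ! k)" using jl len nth by auto
  qed
  ultimately have "hole (w # qs)"
    using jl len sub w(2) by (auto simp: hole_Cons)
  moreover have "set (w # qs) \<subseteq> S" using sub ps(2) w(1) by auto
  ultimately show False using S unfolding chordal_on_def by blast
qed

section \<open>From a hole and a corner to a wheel\<close>

lemma list_change:
  assumes "x \<in> set xs" "P x" "y \<in> set xs" "\<not> P y"
  shows "\<exists>i. Suc i < length xs \<and> P (xs ! i) \<noteq> P (xs ! Suc i)"
proof (rule ccontr)
  assume "\<not> ?thesis"
  then have step: "P (xs ! i) = P (xs ! Suc i)" if "Suc i < length xs" for i using that by blast
  have "P (xs ! i) = P (xs ! 0)" if "i < length xs" for i
    using that
  proof (induction i)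
    case (Suc i)
    then show ?case using step[of i] by simp
  qed simp
  with assms show False by (metis in_set_conv_nth)
qed

text \<open>Supplies the rim hypothesis of \<open>outer_1_planar_no_wheel\<close>: a hole without
  \<open>u\<close> is a path, and membership in \<open>A\<close> changes somewhere along it.\<close>

lemma hole_minus_vertex_connected:
  assumes "hole vs" "u \<in> set vs"
  shows "connected_on (set vs - {u})"
  unfolding connected_on_def
proof (intro allI impI)
  fix A assume A: "A \<subset> set vs - {u}" "A \<noteq> {}"
  obtain ps where ps: "hole (u # ps)" "set vs = insert u (set ps)"
    using hole_rotate_to assms by blast
  then have eq: "set vs - {u} = set ps" by (auto simp: hole_Cons)
  obtain x y where "x \<in> set ps" "x \<in> A" "y \<in> set ps" "y \<notin> A" using A eq by blast
  then obtain i where i: "Suc i < length ps" "(ps ! i \<in> A) \<noteq> (ps ! Suc i \<in> A)"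
    using list_change[of x ps "\<lambda>x. x \<in> A" y] by blast
  have "E (ps ! i) (ps ! Suc i)" "E (ps ! Suc i) (ps ! i)"
    using ps(1) i(1) by (auto simp: hole_Cons induced_path_def)
  moreover have "ps ! i \<in> set ps" "ps ! Suc i \<in> set ps" using i(1) by auto
  ultimately show "\<exists>x\<in>A. \<exists>y\<in>set vs - {u} - A. E x y" using i(2) eq by blast
qed

text \<open>
  Every hole passes through \<open>v\<close>. Replacing \<open>v\<close> by \<open>w\<close> closes the remaining path with a
  vertex outside of the hole, and chordality of the rest makes that vertex a hub.
\<close>
lemma corner_imp_wheel:
  assumes c: "corner S v w" and ch: "chordal_on (S - {v})" and vs: "hole vs" "set vs \<subseteq> S"
  shows "w \<notin> set vs" "\<forall>u\<in>set vs. E w u"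
proof -
  have "v \<in> set vs" using ch vs unfolding chordal_on_def by blast
  then obtain ps where ps: "hole (v # ps)" "set vs = insert v (set ps)"
    using hole_rotate_to vs(1) by blast
  define n where "n = length ps"
  note h = ps(1)[unfolded hole_Cons, folded n_def]
  have vw: "v \<noteq> w" using c irrefl by (auto simp: corner_def)
  have dom: "x = w \<or> E w x" if "x \<in> set ps" "E v x" for x
    using c that ps(2) vs(2) unfolding corner_def by blast
  have pne: "ps \<noteq> []" using h by (auto simp: n_def)
  have E0: "E v (ps ! 0)" "E v (ps ! (n - 1))" using h by auto
  have mem: "ps ! 0 \<in> set ps" "ps ! (n - 1) \<in> set ps" using pne by (auto simp: n_def)
  have n: "0 < n" "n - 1 < n" "n - 1 \<noteq> 0" "n - 1 \<noteq> Suc 0" using h by auto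
  then have ne: "ps ! 0 \<noteq> ps ! (n - 1)" "\<not> E (ps ! 0) (ps ! (n - 1))"
    using h unfolding induced_path_def n_def[symmetric] by (auto simp: nth_eq_iff_index_eq n_def)
  \<comment> \<open>Being adjacent to \<open>v\<close>, the vertex \<open>w\<close> could only be an
    end of the path. It would then have to dominate the other end, but the two ends are distinct and
    not adjacent.\<close>
  have w: "w \<notin> set ps"
  proof
    assume "w \<in> set ps"
    then obtain i where i: "i < n" "w = ps ! i" by (auto simp: in_set_conv_nth n_def)
    have "E v w" using c by (simp add: corner_def)
    then have "i = 0 \<or> Suc i = n" using h i by auto
    then have "w = ps ! 0 \<or> w = ps ! (n - 1)" using i by auto
    then show False using dom mem E0 ne sym by metis
  qed
  show "w \<notin> set vs" using w vw ps(2) by auto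
  have "E w (ps ! 0)" "E w (ps ! (n - 1))" using dom mem E0 w by metis+
  then have "E w (hd ps)" "E w (last ps)" using pne by (auto simp: hd_conv_nth last_conv_nth n_def)
  moreover have "set ps \<subseteq> S - {v}" using ps(2) vs(2) h by blast
  moreover have "w \<in> S - {v}" using c vw by (auto simp: corner_def)
  ultimately have "E w x" if "x \<in> set ps" for x
    using chordal_on_fan[OF ch _ _ pne] h w that by blast
  moreover have "E w v" using c sym by (auto simp: corner_def)
  ultimately show "\<forall>u\<in>set vs. E w u" using ps(2) by auto
qed

end

section \<open>Dismantling and the game\<close>

context sym_irrefl
begin

section \<open>The game as a recursion with a bounded number of moves\<close>

definition adj_or_eq :: "'a \<Rightarrow> 'a \<Rightarrow> bool" where
  "adj_or_eq x y \<longleftrightarrow> x = y \<or> E x y"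

text \<open>
  \<open>catches S n c r\<close>: on the graph induced on \<open>S\<close>, a cop on \<open>c\<close> who is to move catches the
  robber on \<open>r\<close> within \<open>n\<close> moves.
\<close>
fun catches :: "'a set \<Rightarrow> nat \<Rightarrow> 'a \<Rightarrow> 'a \<Rightarrow> bool" where
  "catches S 0 c r \<longleftrightarrow> c = r"
| "catches S (Suc n) c r \<longleftrightarrow> (\<exists>c'\<in>S. adj_or_eq c c' \<and>
     (c' = r \<or> (\<forall>r'\<in>S. adj_or_eq r r' \<longrightarrow> catches S n c' r')))"

lemma catches_Suc: "c \<in> S \<Longrightarrow> catches S n c r \<Longrightarrow> catches S (Suc n) c r"
proof (induction n arbitrary: c r)
  case 0
  then show ?case by (auto simp: adj_or_eq_def)
next
  case (Suc n)
  then obtain c' where c': "c' \<in> S" "adj_or_eq c c'"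
    "c' = r \<or> (\<forall>r'\<in>S. adj_or_eq r r' \<longrightarrow> catches S n c' r')" by auto
  then have "c' = r \<or> (\<forall>r'\<in>S. adj_or_eq r r' \<longrightarrow> catches S (Suc n) c' r')"
    using Suc.IH by blast
  with c' show ?case unfolding catches.simps(2)[of S "Suc n"] by blast
qed

lemma catches_dominated:
  assumes "corner S v w"
  shows "catches S (Suc n) w v"
  using assms sym by (auto simp: corner_def adj_or_eq_def)

text \<open>
  The cop plays on \<open>S - {v}\<close> against the image of the robber under the folding of \<open>v\<close> onto
  \<open>w\<close>. When the image is caught while the robber is on \<open>v\<close>, one more move catches him.
\<close>
lemma catches_unfold:
  assumes c: "corner S v w"
  shows "k \<in> S - {v} \<Longrightarrow> r \<in> S \<Longrightarrow> catches (S - {v}) n k (if r = v then w else r) \<Longrightarrow>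
    catches S (Suc n) k r"
proof (induction n arbitrary: k r)
  case 0
  show ?case
  proof (cases "r = v")
    case True
    then have "k = w" using 0 by simp
    with True show ?thesis using catches_dominated[OF c, of 0] by (simp only:)
  next
    case False
    then have "k = r" using 0 by simp
    then show ?thesis using 0 catches_Suc[of k S 0 r] by simp
  qed
next
  case (Suc n)
  let ?f = "\<lambda>r. if r = v then w else r"
  obtain k' where k': "k' \<in> S - {v}" "adj_or_eq k k'"
    "k' = ?f r \<or> (\<forall>r'\<in>S - {v}. adj_or_eq (?f r) r' \<longrightarrow> catches (S - {v}) n k' r')"
    using Suc.prems by auto
  have fold: "?f r' \<in> S - {v} \<and> adj_or_eq (?f r) (?f r')" if "r' \<in> S" "adj_or_eq r r'" for r'
    using that c sym irrefl Suc.prems(2) by (auto simp: corner_def adj_or_eq_def)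
  have "k' = r \<or> (\<forall>r'\<in>S. adj_or_eq r r' \<longrightarrow> catches S (Suc n) k' r')"
    using k'(3)
  proof
    assume k'eq: "k' = ?f r"
    show ?thesis
    proof (cases "r = v")
      case True
      have "catches S (Suc n) w r'" if "r' \<in> S" "adj_or_eq v r'" for r'
      proof -
        have "adj_or_eq w r'"
          using that c sym by (auto simp: corner_def adj_or_eq_def)
        then show ?thesis using that by auto
      qed
      with True k'eq show ?thesis by auto
    qed (use k'eq in simp)
  next
    assume "\<forall>r'\<in>S - {v}. adj_or_eq (?f r) r' \<longrightarrow> catches (S - {v}) n k' r'"
    then show ?thesis using fold Suc.IH[OF k'(1)] by blast
  qed
  with k' show ?case unfolding catches.simps(2)[of S "Suc n"] by blast
qed

lemma chordal_on_imp_catches: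
  assumes "finite S" "chordal_on S" "connected_on S" "S \<noteq> {}"
  shows "\<exists>c\<in>S. \<exists>n. \<forall>r\<in>S. catches S n c r"
  using assms
proof (induction "card S" arbitrary: S rule: less_induct)
  case less
  show ?case
  proof (cases "2 \<le> card S")
    case True
    obtain v w where vw: "corner S v w"
      using chordal_on_imp_corner less.prems True by blast
    have v: "v \<in> S" "w \<in> S - {v}" using vw irrefl by (auto simp: corner_def)
    have "card (S - {v}) < card S" using v less.prems(1) by (intro card_Diff1_less)
    moreover have "chordal_on (S - {v})" using less.prems(2) chordal_on_subset by blast
    moreover have "connected_on (S - {v})"
      using connected_on_remove_corner[OF less.prems(3) vw] .
    ultimately obtain c n where c: "c \<in> S - {v}" "\<forall>r\<in>S - {v}. catches (S - {v}) n c r"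
      using less.hyps[of "S - {v}"] less.prems(1) v by blast
    \<comment> \<open>Each re-inserted vertex costs at most one further move, so the bound remains
      uniform in \<open>r\<close>.\<close>
    have "catches S (Suc n) c r" if "r \<in> S" for r
      using catches_unfold[OF vw c(1) that] c(2) v that by simp
    with c(1) show ?thesis by blast
  next
    case False
    moreover have "card S \<noteq> 0" using less.prems by simp
    ultimately have "card S = 1" by simp
    then obtain c where "S = {c}" by (auto simp: card_1_singleton_iff)
    then show ?thesis by (intro bexI[of _ c] exI[of _ 0]) auto
  qed
qed

end

text \<open>Turns the recursion into a strategy on histories. The length of the history serves as a
  clock that tells the cop how many moves remain.\<close>

lemma cop_winI:
  fixes G :: "('a, 'b) pre_digraph"
  assumes "sym_irrefl E" and E: "\<And>x y. E x y \<longleftrightarrow> x \<rightarrow>\<^bsub>G\<^esub> y"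
    and c: "c \<in> verts G" and win: "\<And>r. r \<in> verts G \<Longrightarrow> sym_irrefl.catches E (verts G) N c r"
  shows "cop_win G"
proof -
  interpret sym_irrefl E by fact
  let ?V = "verts G"
  have legal: "legal_move G x y \<longleftrightarrow> x \<in> ?V \<and> y \<in> ?V \<and> adj_or_eq x y" for x y
    by (auto simp: legal_move_def adj_or_eq_def E)
  \<comment> \<open>Legality is demanded even where nothing is promised, since a strategy must stay
    legal in every position, also after a capture.\<close>
  define good where "good n k r k' \<longleftrightarrow> legal_move G k k' \<and> (catches ?V (Suc n) k r \<longrightarrow>
      k' = r \<or> (\<forall>r'. legal_move G r r' \<longrightarrow> catches ?V n k' r'))" for n k r k'
  define move where "move n k r = (SOME k'. good n k r k')" for n k r
  have "\<exists>k'. good n k r k'" if "k \<in> ?V" for n k r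
  proof (cases "catches ?V (Suc n) k r")
    case True
    then show ?thesis using that by (auto simp: good_def legal)
  next
    case False
    moreover have "legal_move G k k" using that by (simp add: legal adj_or_eq_def)
    ultimately show ?thesis unfolding good_def by blast
  qed
  then have "good n k r (move n k r)" if "k \<in> ?V" for n k r
    unfolding move_def using that by (metis someI_ex)
  then have move: "\<And>n k r. k \<in> ?V \<Longrightarrow> legal_move G k (move n k r)"
    "\<And>n k r r'. k \<in> ?V \<Longrightarrow> catches ?V (Suc n) k r \<Longrightarrow> move n k r \<noteq> r \<Longrightarrow>
       legal_move G r r' \<Longrightarrow> catches ?V n (move n k r) r'"
    unfolding good_def by blast+
  \<comment> \<open>The budget passed to \<open>move\<close> is the one left after that move, hence
    \<open>N - Suc i\<close>. It is truncated to 0 once the clock has run out.\<close>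
  define pos where "pos r n = rec_nat c (\<lambda>i k. move (N - Suc i) k (r i)) n" for r :: "nat \<Rightarrow> 'a" and n
  define s where "s xs = [pos (\<lambda>i. xs ! i) (length xs)]" for xs
  have pos_cong: "pos r n = pos r' n" if "\<And>i. i < n \<Longrightarrow> r i = r' i" for r r' n
    using that by (induction n) (auto simp: pos_def)
  have cops: "cops_at s r n = [pos r n]" for r n
    using pos_cong[of n "\<lambda>i. map r [0..<n] ! i" r] by (simp add: cops_at_def s_def)
  have pos_V: "pos r n \<in> ?V" for r n
  proof (induction n)
    case (Suc n)
    then show ?case using move(1)[OF Suc] by (auto simp: pos_def legal)
  qed (use c in \<open>simp add: pos_def\<close>)
  have pos_Suc: "pos r (Suc n) = move (N - Suc n) (pos r n) (r n)" for r n
    by (simp add: pos_def)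
  have "cop_strategy G 1 s"
    unfolding cop_strategy_def cops using c move(1)[OF pos_V]
    by (auto simp: s_def pos_Suc) (auto simp: pos_def)
  moreover have "\<exists>n. r n \<in> set (cops_at s r n) \<or> r n \<in> set (cops_at s r (Suc n))"
    if r: "robber_play G r" for r
  proof (rule ccontr)
    assume *: "\<not> ?thesis"
    have free: "pos r n \<noteq> r n" "pos r (Suc n) \<noteq> r n" for n
      using * unfolding cops by (metis list.set_intros(1))+
    have r_legal: "legal_move G (r n) (r (Suc n))" for n using r by (simp add: robber_play_def)
    \<comment> \<open>At \<open>n = N\<close> the budget is 0, and \<open>catches\<close> then says
      that the cop stands on the robber's vertex.\<close>
    have "n \<le> N \<Longrightarrow> catches ?V (N - n) (pos r n) (r n)" for n
    proof (induction n)
      case 0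
      have "r 0 \<in> ?V" using r_legal[of 0] by (simp add: legal)
      then show ?case using win by (simp add: pos_def)
    next
      case (Suc n)
      then have "catches ?V (Suc (N - Suc n)) (pos r n) (r n)" by (simp add: Suc_diff_Suc)
      then show ?case
        using move(2)[OF pos_V] free(2)[of n] r_legal[of n] unfolding pos_Suc by blast
    qed
    from this[of N] show False using free(1)[of N] by simp
  qed
  ultimately show ?thesis
    by (auto simp: cop_win_def cops_win_def)
qed

text \<open>
  The robber stays on \<open>K\<close> and avoids the closed neighbourhood of the image of the cop under
  the retraction \<open>f\<close>. This is possible because that image dominates no vertex of \<open>K\<close>.
\<close>
lemma robber_evades_on_retract:
  fixes G :: "('a, 'b) pre_digraph"
  assumes "sym_irrefl E" and E: "\<And>x y. E x y \<longleftrightarrow> x \<rightarrow>\<^bsub>G\<^esub> y"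
    and K: "K \<subseteq> verts G" "x0 \<in> K" "y0 \<in> K" "x0 \<noteq> y0"
    and no_corner: "\<And>v w. \<not> sym_irrefl.corner E K v w"
    and f: "f ` verts G \<subseteq> K" "\<And>x. x \<in> K \<Longrightarrow> f x = x"
      "\<And>x y. x \<in> verts G \<Longrightarrow> y \<in> verts G \<Longrightarrow> E x y \<Longrightarrow> f x = f y \<or> E (f x) (f y)"
  shows "\<not> cop_win G"
proof
  interpret sym_irrefl E by fact
  assume "cop_win G"
  then obtain s where s: "cop_strategy G 1 s"
    and win: "\<And>r. robber_play G r \<Longrightarrow>
        \<exists>n. r n \<in> set (cops_at s r n) \<or> r n \<in> set (cops_at s r (Suc n))"
    unfolding cop_win_def cops_win_def by blast
  let ?V = "verts G"
  have legal: "legal_move G x y \<longleftrightarrow> x \<in> ?V \<and> y \<in> ?V \<and> adj_or_eq x y" for x y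
    by (auto simp: legal_move_def adj_or_eq_def E)
  define safe where "safe xs y \<longleftrightarrow> y \<in> K \<and> (xs \<noteq> [] \<longrightarrow> adj_or_eq (last xs) y) \<and>
    \<not> adj_or_eq (f (hd (s xs))) y" for xs y
  \<comment> \<open>The defaults keep the play legal even without a safe vertex. Legality has to
    come first: only against a legal play is the cop known to move along edges, and the existence of
    safe vertices is derived from that.\<close>
  define pick where "pick xs = (if \<exists>y. safe xs y then SOME y. safe xs y else
    if xs = [] then x0 else last xs)" for xs
  define h where "h n = rec_nat [] (\<lambda>_ xs. xs @ [pick xs]) n" for n :: nat
  define r where "r n = pick (h n)" for n
  have h_Suc: "h (Suc n) = h n @ [r n]" for n by (simp add: h_def r_def)
  have h_0: "h 0 = []" by (simp add: h_def)
  have h: "map r [0..<n] = h n" for n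
    by (induction n) (simp_all add: h_0 h_Suc)
  have pick_safe: "safe xs (pick xs)" if "safe xs y" for xs y
    using that unfolding pick_def by (metis someI)
  have r_K: "r n \<in> K" for n
  proof (induction n)
    case 0
    show ?case
    proof (cases "\<exists>y. safe [] y")
      case True
      then show ?thesis using pick_safe by (auto simp: r_def h_0 safe_def)
    qed (use K in \<open>simp add: r_def h_0 pick_def\<close>)
  next
    case (Suc n)
    show ?case
    proof (cases "\<exists>y. safe (h (Suc n)) y")
      case True
      then show ?thesis using pick_safe unfolding r_def safe_def by blast
    next
      case False
      then have "r (Suc n) = last (h (Suc n))" by (simp add: r_def pick_def h_Suc)
      with Suc show ?thesis by (simp add: h_Suc)
    qed
  qed
  have play: "robber_play G r"
    unfolding robber_play_def
  proof
    fix n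
    have "adj_or_eq (r n) (r (Suc n))"
    proof (cases "\<exists>y. safe (h (Suc n)) y")
      case True
      then have "safe (h (Suc n)) (r (Suc n))" using pick_safe unfolding r_def by blast
      then show ?thesis by (simp add: safe_def h_Suc)
    next
      case False
      then have "r (Suc n) = last (h (Suc n))" by (simp add: r_def pick_def h_Suc)
      then show ?thesis by (simp add: h_Suc adj_or_eq_def)
    qed
    then show "legal_move G (r n) (r (Suc n))" using r_K K(1) by (auto simp: legal)
  qed
  define c where "c n = hd (s (h n))" for n
  have moves: "list_all2 (legal_move G) (cops_at s r n) (cops_at s r (Suc n))" for n
    using s play by (simp add: cop_strategy_def)
  have len: "length (cops_at s r n) = 1" for n
  proof (induction n)
    case 0
    show ?case using s by (simp add: cops_at_def cop_strategy_def)
  next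
    case (Suc n)
    then show ?case using list_all2_lengthD[OF moves[of n]] by simp
  qed
  have cops: "cops_at s r n = [c n]" for n
    using len[of n] by (cases "cops_at s r n") (auto simp: c_def cops_at_def h)
  have c_legal: "legal_move G (c n) (c (Suc n))" for n using moves[of n] by (simp add: cops)
  have c_V: "c n \<in> ?V" for n using c_legal[of n] by (simp add: legal)
  have fc_K: "f (c n) \<in> K" for n using c_V f(1) by blast
  have fc: "adj_or_eq (f (c n)) (f (c (Suc n)))" for n
    using c_legal[of n] f(3) by (auto simp: legal adj_or_eq_def)
  have safe: "\<not> adj_or_eq (f (c n)) (r n)" for n
  proof (induction n)
    case 0
    have "\<exists>y\<in>K. \<not> adj_or_eq (f (c 0)) y"
    proof (rule ccontr)
      assume "\<not> ?thesis"
      then have dom: "adj_or_eq (f (c 0)) y" if "y \<in> K" for y using that by blast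
      obtain v where v: "v \<in> K" "v \<noteq> f (c 0)" using K by metis
      then have "E v (f (c 0))" using dom[OF v(1)] sym by (auto simp: adj_or_eq_def)
      then have "corner K v (f (c 0))"
        using dom v fc_K by (auto simp: corner_def adj_or_eq_def)
      with no_corner show False by blast
    qed
    then have "\<exists>y. safe (h 0) y" by (auto simp: safe_def h_0 c_def)
    then have "safe (h 0) (r 0)" using pick_safe unfolding r_def by blast
    then show ?case by (simp add: safe_def c_def)
  next
    case (Suc n)
    let ?c = "f (c (Suc n))"
    \<comment> \<open>Without such a \<open>y\<close>, the retracted cop would dominate the robber's
      vertex, which would thus be a corner of \<open>K\<close>.\<close>
    have "\<exists>y\<in>K. adj_or_eq (r n) y \<and> \<not> adj_or_eq ?c y"
    proof (rule ccontr)
      assume "\<not> ?thesis"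
      then have dom: "adj_or_eq ?c y" if "y \<in> K" "adj_or_eq (r n) y" for y
        using that by blast
      have "?c \<noteq> r n" using Suc fc[of n] by auto
      moreover have "adj_or_eq ?c (r n)" using dom r_K by (auto simp: adj_or_eq_def)
      ultimately have "E (r n) ?c" using sym by (auto simp: adj_or_eq_def)
      then have "corner K (r n) ?c"
        using dom r_K fc_K by (auto simp: corner_def adj_or_eq_def)
      with no_corner show False by blast
    qed
    then have "\<exists>y. safe (h (Suc n)) y" by (auto simp: safe_def h_Suc c_def)
    then have "safe (h (Suc n)) (r (Suc n))" using pick_safe unfolding r_def by blast
    then show ?case by (simp add: safe_def c_def)
  qed
  \<comment> \<open>Safety also covers the cop's reply: the robber's vertex is fixed by
    \<open>f\<close>, and the image of the cop moves by at most one edge.\<close>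
  obtain n where "r n = c n \<or> r n = c (Suc n)" using win[OF play] by (auto simp: cops)
  then show False
  proof
    assume "r n = c n"
    then have "f (c n) = r n" using f(2) r_K by metis
    then show False using safe[of n] by (simp add: adj_or_eq_def)
  next
    assume "r n = c (Suc n)"
    then have "f (c (Suc n)) = r n" using f(2) r_K by metis
    then show False using safe[of n] fc[of n] by simp
  qed
qed

section \<open>Dismantling a cop-win graph\<close>

context sym_irrefl
begin

lemma outer_1_planar_chordal_add_corner:
  fixes G :: "('a, 'b) pre_digraph"
  assumes E: "\<And>x y. E x y \<longleftrightarrow> x \<rightarrow>\<^bsub>G\<^esub> y"
    and G: "finite (verts G)" "outer_1_planar G"
    and S: "S \<subseteq> verts G" "corner S v w" "chordal_on (S - {v})"
  shows "chordal_on S"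
  unfolding chordal_on_def
proof
  assume "\<exists>vs. hole vs \<and> set vs \<subseteq> S"
  then obtain vs where vs: "hole vs" "set vs \<subseteq> S" by blast
  note wheel = corner_imp_wheel[OF S(2,3) vs]
  have uedge: "{x, y} \<in> uedges G" if "E x y" for x y
    using that by (auto simp: uedges_def E)
  show False
  proof (rule outer_1_planar_no_wheel[OF G, of "set vs" w])
    show "set vs \<subseteq> verts G" using vs(2) S(1) by blast
    show "4 \<le> card (set vs)" using vs(1) by (simp add: hole_def distinct_card)
    show "w \<in> verts G" using S by (auto simp: corner_def)
    show "w \<notin> set vs" by (rule wheel)
    show "{w, u} \<in> uedges G" if "u \<in> set vs" for u using wheel(2) that uedge by blast
    show "\<exists>x\<in>A. \<exists>y\<in>set vs - {u} - A. {x, y} \<in> uedges G"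
      if "u \<in> set vs" "A \<subset> set vs - {u}" "A \<noteq> {}" for u A
      using hole_minus_vertex_connected[OF vs(1) that(1)] that(2,3) uedge
      unfolding connected_on_def by meson
  qed
qed

text \<open>The induction carries a retraction of the whole graph onto \<open>S\<close>. So the game
  and the drawing are always those of \<open>G\<close>, and neither property has to be passed on to
  subgraphs.\<close>

lemma cop_win_retract_chordal:
  fixes G :: "('a, 'b) pre_digraph"
  assumes E: "\<And>x y. E x y \<longleftrightarrow> x \<rightarrow>\<^bsub>G\<^esub> y"
    and G: "finite (verts G)" "outer_1_planar G" "cop_win G"
    and S: "S \<subseteq> verts G"
    and f: "f ` verts G \<subseteq> S" "\<And>x. x \<in> S \<Longrightarrow> f x = x"
      "\<And>x y. x \<in> verts G \<Longrightarrow> y \<in> verts G \<Longrightarrow> E x y \<Longrightarrow> f x = f y \<or> E (f x) (f y)"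
  shows "chordal_on S"
  using S f
proof (induction "card S" arbitrary: S f rule: less_induct)
  case less
  have fin: "finite S" using less.prems(1) G(1) finite_subset by blast
  show ?case
  proof (cases "\<exists>x\<in>S. \<exists>y\<in>S. x \<noteq> y")
    case True
    then obtain x y where xy: "x \<in> S" "y \<in> S" "x \<noteq> y" by blast
    have "\<exists>v w. corner S v w"
      using robber_evades_on_retract[OF sym_irrefl_axioms E less.prems(1) xy _ less.prems(2-4)] G(3)
      by blast
    then obtain v w where vw: "corner S v w" by blast
    have v: "v \<in> S" "w \<in> S" "v \<noteq> w" "E v w" using vw irrefl by (auto simp: corner_def)
    \<comment> \<open>The retraction \<open>f\<close> followed by the folding of \<open>v\<close>
      onto \<open>w\<close>.\<close>
    define g where "g x = (if f x = v then w else f x)" for x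
    have dom: "y = w \<or> E w y" if "y \<in> S" "E v y" for y
      using vw that by (auto simp: corner_def)
    have "chordal_on (S - {v})"
    proof (rule less.hyps[of "S - {v}" g])
      show "card (S - {v}) < card S" using fin v by (intro card_Diff1_less)
      show "S - {v} \<subseteq> verts G" using less.prems(1) by blast
      show "g ` verts G \<subseteq> S - {v}" using less.prems(2) v by (auto simp: g_def)
      show "g x = x" if "x \<in> S - {v}" for x using that less.prems(3) by (simp add: g_def)
      show "g x = g y \<or> E (g x) (g y)" if xy: "x \<in> verts G" "y \<in> verts G" "E x y" for x y
      proof -
        have fS: "f x \<in> S" "f y \<in> S" using less.prems(2) xy by auto
        have "f x = f y \<or> E (f x) (f y)" using less.prems(4) xy by blast
        then show ?thesis
          using dom[OF fS(1)] dom[OF fS(2)] sym[of "f x" "f y"] sym[of w "f x"] irrefl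
          unfolding g_def by (cases "f x = v"; cases "f y = v") auto
      qed
    qed
    then show ?thesis
      using outer_1_planar_chordal_add_corner[OF E G(1,2) less.prems(1) vw] by blast
  next
    case False
    have "\<not> hole vs" if "set vs \<subseteq> S" for vs
    proof
      assume "hole vs"
      then have vs: "distinct vs" "0 < length vs" "1 < length vs" by (auto simp: hole_def)
      then have "vs ! 0 \<noteq> vs ! 1" "vs ! 0 \<in> set vs" "vs ! 1 \<in> set vs"
        using nth_eq_iff_index_eq[of vs 0 1] nth_mem by auto
      with False that show False by blast
    qed
    then show ?thesis by (auto simp: chordal_on_def)
  qed
qed

end

theorem theorem5:
  fixes G :: "('a, 'b) pre_digraph"
  assumes "graph G" and "Digraph_Component.connected G" and "outer_1_planar G"
  shows "cop_win G \<longleftrightarrow> chordal G"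
proof -
  interpret graph G by fact
  define E where "E x y \<longleftrightarrow> x \<rightarrow>\<^bsub>G\<^esub> y" for x y
  interpret sym_irrefl E
  proof
    show "E x y \<Longrightarrow> E y x" for x y
      using sym_arcs by (auto simp: E_def symmetric_def dest: symD)
    show "\<not> E x x" for x
      using adj_not_same by (auto simp: E_def)
  qed
  have chordal: "chordal G \<longleftrightarrow> chordal_on (verts G)"
    by (auto simp: chordal_def chordal_on_def induced_cycle_def hole_def E_def)
  \<comment> \<open>By symmetry of the arcs, connectedness yields directed walks, and a walk from
    \<open>A\<close> to its complement has to use an edge of the cut.\<close>
  have strong: "strongly_connected G"
    using symmetric_connected_imp_strongly_connected[OF sym_arcs assms(2)] .
  then have "verts G \<noteq> {}" by (auto simp: strongly_connected_def)
  have conn: "connected_on (verts G)"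
    unfolding connected_on_def
  proof (intro allI impI, rule ccontr)
    fix A assume A: "A \<subset> verts G" "A \<noteq> {}"
      and no: "\<not> (\<exists>x\<in>A. \<exists>y\<in>verts G - A. E x y)"
    obtain a b where ab: "a \<in> A" "b \<in> verts G - A" using A by blast
    then have "a \<rightarrow>\<^sup>*\<^bsub>G\<^esub> b" using strong A by (auto simp: strongly_connected_def)
    then have "b \<in> A"
    proof (induction rule: reachable_induct)
      case (step x y)
      then have "y \<in> verts G" using adj_in_verts by blast
      with step no show ?case by (auto simp: E_def)
    qed (use ab in simp)
    with ab show False by simp
  qed
  show ?thesis
    unfolding chordal
  proof
    assume "cop_win G"
    then show "chordal_on (verts G)"
      by (intro cop_win_retract_chordal[where f = id, OF E_def finite_verts assms(3)]) auto
  next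
    assume "chordal_on (verts G)"
    then obtain c n where "c \<in> verts G" "\<forall>r\<in>verts G. catches (verts G) n c r"
      using chordal_on_imp_catches[OF finite_verts _ conn \<open>verts G \<noteq> {}\<close>] by blast
    then show "cop_win G"
      using cop_winI[OF sym_irrefl_axioms E_def] by blast
  qed
qed

end
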